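(* Let $X,Y$ be $c$-free with respect to $(\varphi,\psi)$ on $\mathbb{C}\langle X,Y\rangle$. Define a linear map $\overrightarrow{E}^\varphi_X:\mathbb{C}\langle X,Y\rangle\to\mathbb{C}\langle X\rangle$ recursively on monomials (by induction on block length) by: (i) $\overrightarrow{E}^\varphi_X[P(X)]=P(X)$ for $P\in\mathbb{C}\langle X\rangle$; (ii) $\overrightarrow{E}^\varphi_X[P(Y)]=\varphi(P(Y))$ for $P\in\mathbb{C}\langle Y\rangle$; (iii) if the monomial $W$ starts with $Y$: $\overrightarrow{E}^\varphi_X[W]=\beta^{b,\varphi}_Y(W)+(\beta^{b,\varphi}_Y\otimes\overrightarrow{E}^\varphi_X)[\overrightarrow{\delta}_XW]$; (iv) if $W$ starts with $X$: $\overrightarrow{E}^\varphi_X[W]=E^\psi_X[W]+\bigl(\beta^{b,\varphi}_X\otimes(\overrightarrow{E}^\varphi_X-E^\psi_X)\bigr)[\overrightarrow{\delta}_YW]$. Then $\overrightarrow{E}^\varphi_X$ is well defined and is a right quasi-conditional expectation for $\varphi$ onto $\mathbb{C}\langle X\rangle$, i.e. $\varphi(\overrightarrow{E}^\varphi_X[P])=\varphi(P)$ for all $P\in\mathbb{C}\langle X,Y\rangle$ and $\overrightarrow{E}^\varphi_X[PQ(X)]=\overrightarrow{E}^\varphi_X[P]Q(X)$ for all $P\in\mathbb{C}\langle X,Y\rangle$, $Q\in\mathbb{C}\langle X\rangle$. Moreover, for every monomial $W$, $$\overrightarrow{E}^\varphi_X[W]=\beta^{b,\varphi}_Y(W)+(\mathring\beta^{b,\varphi}_Y\otimes\overrightarrow{E}^\varphi_X)[\overrightarrow{\delta}_XW]+\bigl(\mathring\beta^{b,\varphi}_X\otimes(\overrightarrow{E}^\varphi_X-E^\psi_X)\bigr)[\overrightarrow{\delta}_YW]+X\,E^\psi_X[L_X(W)],$$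 where $\mathring\beta^{b,\varphi}_{\bullet}=\beta^{b,\varphi}_{\bullet}-\epsilon$ and $L_X(W)=W'$ if $W=XW'$, $L_X(W)=0$ otherwise.
   Context: $\epsilon(P)$ is the constant coefficient of $P$. $X,Y$ are $c$-free w.r.t. $(\varphi,\psi)$ (unital functionals on $\mathbb{C}\langle X,Y\rangle$) if $\psi(u_1\cdots u_n)=0$ and $\varphi(u_1\cdots u_n)=\prod\varphi(u_j)$ whenever the $u_j$ alternate between $\mathbb{C}\langle X\rangle$ and $\mathbb{C}\langle Y\rangle$ and $\psi(u_j)=0$. Boolean cumulants $\beta^\theta_n$: $\theta(a_1\cdots a_n)=\sum_k\beta^\theta_k(a_1,\dots,a_k)\theta(a_{k+1}\cdots a_n)$. Block factorization of a monomial $W\ne1$: $W=U_1\cdots U_n$, nonempty pure-$X$/pure-$Y$ monomials alternating (block length $n$). $\beta^{b,\theta}_X(1)=1$, $\beta^{b,\theta}_X(W)=\beta^\theta_n(U_1,\dots,U_n)$ if $W$ starts and ends with the letter $X$, else $0$; $\beta^{b,\theta}_Y$ analogously. $\overrightarrow{\delta}_X(W)=\sum_{W=UXV}U\otimes XV$ over all factorizations with monomials $U,V$ (similarly $\overrightarrow{\delta}_Y$), extended linearly; $(f\otimes g)(U\otimes V)=f(U)g(V)$. $E^\psi_X:\mathbb{C}\langle X,Y\rangle\to\mathbb{C}\langle X\rangle$ is linear with, for $W=X_0Y_1X_1\cdots Y_nX_n$ in block form ($X_0,X_n$ possibly $1$), $E^\psi_X[X_0]=X_0$ and for $n\ge1$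 $E^\psi_X[W]=\sum_{p=0}^{n-1}\sum_{0=i_0<i_1<\dots<i_p<i_{p+1}=n}X_0X_{i_1}\cdots X_{i_p}X_n\prod_{j=0}^p\beta^\psi_{2(i_{j+1}-i_j)-1}(Y_{i_j+1},X_{i_j+1},\dots,Y_{i_{j+1}})$. *)

theory Defs
  imports Complex_Main "HOL-Library.Function_Algebras"
begin

datatype letter = LX | LY

type_synonym word = "letter list"   \<comment> \<open>monomials of C<X,Y>; [] is the unit 1\<close>
type_synonym ncpoly = "word \<Rightarrow> complex"  \<comment> \<open>coefficient functions (finite support)\<close>

definition is_poly :: "ncpoly \<Rightarrow> bool" where
  "is_poly P \<longleftrightarrow> finite {w. P w \<noteq> 0}"

definition monom :: "word \<Rightarrow> ncpoly" where
  "monom w = (\<lambda>v. if v = w then 1 else 0)"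

definition pone :: ncpoly where "pone = monom []"

definition psmult :: "complex \<Rightarrow> ncpoly \<Rightarrow> ncpoly" (infixr "*s" 75) where
  "c *s P = (\<lambda>w. c * P w)"

definition pmult :: "ncpoly \<Rightarrow> ncpoly \<Rightarrow> ncpoly" where
  "pmult P Q = (\<lambda>w. \<Sum>i\<le>length w. P (take i w) * Q (drop i w))"

definition prodl :: "ncpoly list \<Rightarrow> ncpoly" where
  "prodl us = foldr pmult us pone"

definition in_alg :: "letter \<Rightarrow> ncpoly \<Rightarrow> bool" where
  "in_alg c P \<longleftrightarrow> is_poly P \<and> (\<forall>w. P w \<noteq> 0 \<longrightarrow> set w \<subseteq> {c})"

text \<open>A linear functional is given by its values on monomials; this is its linear extension.\<close>
definition lin :: "(word \<Rightarrow> complex) \<Rightarrow> ncpoly \<Rightarrow> complex" where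
  "lin \<theta> P = (\<Sum>w\<in>{w. P w \<noteq> 0}. P w * \<theta> w)"

definition linE :: "(word \<Rightarrow> ncpoly) \<Rightarrow> ncpoly \<Rightarrow> ncpoly" where
  "linE E P = (\<lambda>v. \<Sum>w\<in>{w. P w \<noteq> 0}. P w * E w v)"

definition cfree :: "(word \<Rightarrow> complex) \<Rightarrow> (word \<Rightarrow> complex) \<Rightarrow> bool" where
  "cfree \<phi> \<psi> \<longleftrightarrow>
    (\<forall>(us :: ncpoly list) (s :: nat \<Rightarrow> letter).
       us \<noteq> [] \<and> (\<forall>j<length us. in_alg (s j) (us ! j) \<and> lin \<psi> (us ! j) = 0)
       \<and> (\<forall>j. Suc j < length us \<longrightarrow> s j \<noteq> s (Suc j))
       \<longrightarrow> lin \<psi> (prodl us) = 0 \<and> lin \<phi> (prodl us) = (\<Prod>j<length us. lin \<phi> (us ! j)))"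

function bcum :: "(word \<Rightarrow> complex) \<Rightarrow> word list \<Rightarrow> complex" where
  "bcum \<theta> us = (if us = [] then 0 else
      \<theta> (concat us) - (\<Sum>k\<in>{1..<length us}. bcum \<theta> (take k us) * \<theta> (concat (drop k us))))"
  by auto
termination by (relation "measure (\<lambda>(\<theta>, us). length us)") auto

declare bcum.simps[simp del]

fun blocks :: "word \<Rightarrow> word list" where
  "blocks [] = []"
| "blocks (a # w) = (case blocks w of [] \<Rightarrow> [[a]]
      | b # bs \<Rightarrow> if hd b = a then (a # b) # bs else [a] # b # bs)"

definition bb :: "(word \<Rightarrow> complex) \<Rightarrow> letter \<Rightarrow> word \<Rightarrow> complex" where
  "bb \<theta> c W = (if W = [] then 1 else if hd W = c \<and> last W = c then bcum \<theta> (blocks W) else 0)"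

definition eps :: "word \<Rightarrow> complex" where "eps W = (if W = [] then 1 else 0)"

definition bbo :: "(word \<Rightarrow> complex) \<Rightarrow> letter \<Rightarrow> word \<Rightarrow> complex" where
  "bbo \<theta> c W = bb \<theta> c W - eps W"

text \<open>(f \<otimes> g)[delta_c W] = sum over W = U c V of f(U) g(c V), for monomial W.\<close>
definition tens :: "(word \<Rightarrow> complex) \<Rightarrow> (word \<Rightarrow> ncpoly) \<Rightarrow> letter \<Rightarrow> word \<Rightarrow> ncpoly" where
  "tens f g c W = (\<Sum>i\<in>{i. i < length W \<and> W ! i = c}. f (take i W) *s g (drop i W))"

text \<open>Block form W = X_0 Y_1 X_1 ... Y_n X_n, padded with empty X_0 / X_n where needed;
  X_i = pad W ! (2i), Y_i = pad W ! (2i-1).\<close>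
definition pad :: "word \<Rightarrow> word list" where
  "pad W = (let bs = blocks W;
               bs1 = (if bs = [] \<or> hd (hd bs) = LY then [] # bs else bs)
           in if last bs1 \<noteq> [] \<and> hd (last bs1) = LY then bs1 @ [[]] else bs1)"

text \<open>(Y_{a+1}, X_{a+1}, ..., Y_b)\<close>
definition seg :: "word list \<Rightarrow> nat \<Rightarrow> nat \<Rightarrow> word list" where
  "seg p a b = take (2 * b - 1 - 2 * a) (drop (2 * a + 1) p)"

definition EpsiX :: "(word \<Rightarrow> complex) \<Rightarrow> word \<Rightarrow> ncpoly" where
  "EpsiX \<psi> W = (let p = pad W; n = length p div 2 in
     if n = 0 then monom W
     else (\<Sum>S\<in>Pow {1..n-1}.
             (let idx = 0 # sorted_list_of_set S @ [n] in
               (\<Prod>j<length idx - 1. bcum \<psi> (seg p (idx ! j) (idx ! Suc j)))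
               *s monom (concat (map (\<lambda>i. p ! (2 * i)) idx)))))"

definition Espec :: "(word \<Rightarrow> complex) \<Rightarrow> (word \<Rightarrow> complex) \<Rightarrow> (word \<Rightarrow> ncpoly) \<Rightarrow> bool" where
  "Espec \<phi> \<psi> E \<longleftrightarrow>
     (\<forall>W. set W \<subseteq> {LX} \<longrightarrow> E W = monom W)
   \<and> (\<forall>W. set W \<subseteq> {LY} \<longrightarrow> E W = \<phi> W *s pone)
   \<and> (\<forall>W. W \<noteq> [] \<and> hd W = LY \<longrightarrow>
          E W = bb \<phi> LY W *s pone + tens (bb \<phi> LY) E LX W)
   \<and> (\<forall>W. W \<noteq> [] \<and> hd W = LX \<longrightarrow>
          E W = EpsiX \<psi> W + tens (bb \<phi> LX) (\<lambda>V. E V - EpsiX \<psi> V) LY W)"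

definition XEL :: "(word \<Rightarrow> complex) \<Rightarrow> word \<Rightarrow> ncpoly" where
  "XEL \<psi> W = (case W of LX # W' \<Rightarrow> pmult (monom [LX]) (EpsiX \<psi> W') | _ \<Rightarrow> 0)"

end

(*
C-freeness gives the moments of tuples of centred alternating entries. Two observations turn this
into statements about monomials. First, a multilinear function of alternating tuples that vanishes
whenever some entry is 1 agrees with its value on the centred tuple. Secondly, for
an identity h(u_1...u_n) = sum_k beta_k(u_1,...,u_k) h(u_{k+1}...u_n), a tuple with an entry 1 reduces
to shorter tuples by the product rule for boolean cumulants. Hence boolean cumulants of alternating
tuples of even length vanish for both functionals, and the identity holds with beta = beta^phi and
h = phi o E^psi_X on tuples starting in C<X>. Recursion (iii) is the recursion defining beta^phi, and in
(iv) the contributions of E^psi_X cancel under phi by this identity, so phi is preserved.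
*)
theory Submission
  imports Defs
begin

text \<open>Centring introduces units, and a unit inside an alternating tuple leaves its two
  neighbours in the same algebra. Merging them restores alternation and shortens the tuple by two,
  at the cost of a product of two shorter terms. The inductions close only because parity makes one
  factor zero: hence even cumulants come first, and the other identities are proved at odd length. A
  unit in last position has no right neighbour, so the last entry gets separate treatment. The
  identity for phi o E^psi_X rests on a twin for psi: on tuples starting in C<Y> the definition of
  E^psi_X is itself a recursion with beta^psi. Centred psi-cumulants vanish at every positive
  length, so E^psi_X vanishes on centred tuples of odd length starting in C<Y>, also when followed
  by a word in X. The recursions (iii) and (iv) cut words at letters, whereas cumulants see blocks.
  The two views agree because beta^b is zero on words with the wrong last letter, while the missing
  cuts, after an even number of blocks, carry vanishing cumulants.\<close>

fun other :: "letter \<Rightarrow> letter" where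
  "other LX = LY"
| "other LY = LX"

lemma other_other [simp]: "other (other c) = c"
  by (cases c) auto

lemma other_neq [simp]: "other c \<noteq> c" "c \<noteq> other c"
  by (cases c; simp)+

lemma neq_other_iff: "a \<noteq> c \<longleftrightarrow> a = other c"
  by (cases a; cases c; simp)

text \<open>Entries are allowed to be empty, so that boolean cumulants may be evaluated at the unit.\<close>
fun alt :: "letter \<Rightarrow> word list \<Rightarrow> bool" where
  "alt c [] = True"
| "alt c (u # us) = (set u \<subseteq> {c} \<and> alt (other c) us)"

lemma alt_append:
  "alt c (p @ q) \<longleftrightarrow> alt c p \<and> alt (if even (length p) then c else other c) q"
  by (induction p arbitrary: c) auto

lemma alt_take: "alt c us \<Longrightarrow> alt c (take k us)"
  by (metis alt_append append_take_drop_id)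

subsection \<open>Boolean cumulants\<close>

text \<open>The right-hand side of the Boolean recursion, with \<open>h\<close> in place of the
  moment functional. The prefix \<open>p\<close> is already inside the cumulant; carrying it along
  makes the sum recursive in \<open>q\<close>.\<close>

definition bsum :: "(word \<Rightarrow> complex) \<Rightarrow> (word \<Rightarrow> complex) \<Rightarrow> word list \<Rightarrow> word list \<Rightarrow> complex" where
  "bsum \<theta> h p q = (\<Sum>j<length q. bcum \<theta> (p @ take (Suc j) q) * h (concat (drop (Suc j) q)))"

lemma bsum_Nil [simp]: "bsum \<theta> h p [] = 0"
  by (simp add: bsum_def)

lemma bsum_Cons:
  "bsum \<theta> h p (u # us) = bcum \<theta> (p @ [u]) * h (concat us) + bsum \<theta> h (p @ [u]) us"
  by (simp add: bsum_def sum.lessThan_Suc_shift del: sum.lessThan_Suc)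

lemma bsum_append:
  "bsum \<theta> h p (a @ b) = bsum \<theta> (\<lambda>w. h (w @ concat b)) p a + bsum \<theta> h (p @ a) b"
  by (induction a arbitrary: p) (auto simp: bsum_Cons)

lemma bcum_Nil [simp]: "bcum \<theta> [] = 0"
  by (simp add: bcum.simps)

lemma bcum_single [simp]: "bcum \<theta> [u] = \<theta> u"
  by (simp add: bcum.simps[of _ "[u]"])

text \<open>The recursion solved for its top cumulant. No other cumulant contains the last entry, so
  that entry can be absorbed into the functional.\<close>

lemma bcum_snoc: "bcum \<theta> (q @ [u]) = \<theta> (concat q @ u) - bsum \<theta> (\<lambda>w. \<theta> (w @ u)) [] q"
proof -
  have "(\<Sum>k\<in>{1..<length (q @ [u])}. bcum \<theta> (take k (q @ [u])) * \<theta> (concat (drop k (q @ [u])))) =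
    (\<Sum>j<length q. bcum \<theta> (take (Suc j) q) * \<theta> (concat (drop (Suc j) q) @ u))"
    by (rule sum.reindex_bij_witness[of _ Suc "\<lambda>k. k - 1"]) auto
  then show ?thesis
    by (subst bcum.simps) (simp add: bsum_def)
qed

lemma moment_bsum:
  assumes "\<theta> [] = 1" "us \<noteq> []"
  shows "\<theta> (concat us) = bsum \<theta> \<theta> [] us"
  using assms(2) by (cases us rule: rev_cases) (auto simp: bsum_append bsum_Cons bcum_snoc assms)

text \<open>The product rule. Merging loses exactly the cut between \<open>a\<close> and
  \<open>b\<close>. By induction the later cuts produce product terms, and together with the lost
  cut these recombine, through the recursion for \<open>b # q\<close>, into the single product on
  the right.\<close>

lemma bcum_merge:
  "bcum \<theta> (p @ (a @ b) # q) = bcum \<theta> (p @ a # b # q) + bcum \<theta> (p @ [a]) * bcum \<theta> (b # q)"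
proof (induction "length q" arbitrary: q rule: less_induct)
  case less
  show ?case
  proof (cases q rule: rev_cases)
    case Nil
    show ?thesis
      using bcum_snoc[of \<theta> p "a @ b"] bcum_snoc[of \<theta> "p @ [a]" b] Nil
      by (simp add: bsum_append bsum_Cons)
  next
    case (snoc q' u)
    let ?h = "\<lambda>w. \<theta> (w @ u)"
    have IH: "bsum \<theta> ?h (p @ [a @ b]) q' =
      bsum \<theta> ?h (p @ [a, b]) q' + bcum \<theta> (p @ [a]) * bsum \<theta> ?h [b] q'"
      using less snoc
      by (simp add: bsum_def sum.distrib sum_distrib_left algebra_simps
          flip: sum.distrib)
    have ab: "bcum \<theta> (p @ [a @ b]) = bcum \<theta> (p @ [a, b]) + bcum \<theta> (p @ [a]) * \<theta> b"
      using less(1)[of "[]"] snoc by simp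
    show ?thesis
      using bcum_snoc[of \<theta> "p @ (a @ b) # q'" u] bcum_snoc[of \<theta> "p @ a # b # q'" u]
        bcum_snoc[of \<theta> "b # q'" u] IH snoc
      by (simp add: bsum_append bsum_Cons ab) (simp add: algebra_simps)
  qed
qed

lemma bsum_merge:
  "bsum \<theta> h (p @ (a @ b) # r) q =
    bsum \<theta> h (p @ a # b # r) q + bcum \<theta> (p @ [a]) * bsum \<theta> h (b # r) q"
  by (simp add: bsum_def bcum_merge sum.distrib sum_distrib_left algebra_simps)

text \<open>With an empty last entry, \<open>bcum_snoc\<close> subtracts from the moment of
  \<open>p\<close> its complete expansion.\<close>

lemma bcum_last_Nil:
  assumes "\<theta> [] = 1" "p \<noteq> []"
  shows "bcum \<theta> (p @ [[]]) = 0"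
  using assms by (simp add: bcum_snoc moment_bsum)

text \<open>Merging an empty first entry into its successor changes nothing, so the product rule
  equates a cumulant with itself plus the term in question.\<close>

lemma bcum_first_Nil:
  assumes "\<theta> [] = 1" "q \<noteq> []"
  shows "bcum \<theta> ([] # q) = 0"
proof -
  obtain b q' where "q = b # q'"
    using assms by (cases q) auto
  then show ?thesis
    using bcum_merge[of \<theta> "[]" "[]" b q'] assms by simp
qed

text \<open>The failure of \<open>h\<close> to satisfy the Boolean recursion with the cumulants of
  \<theta>. It is useful because it obeys the same product rule as the cumulants, so one merging
  argument serves every \<open>h\<close>.\<close>

definition defect :: "(word \<Rightarrow> complex) \<Rightarrow> (word \<Rightarrow> complex) \<Rightarrow> word list \<Rightarrow> complex" where
  "defect \<theta> h us = h (concat us) - bsum \<theta> h [] us"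

lemma defect_merge:
  "defect \<theta> h (p @ a # b # q) = defect \<theta> h (p @ (a @ b) # q) - bcum \<theta> (p @ [a]) * defect \<theta> h (b # q)"
  using bsum_merge[of \<theta> h p a b "[]" q] bcum_merge[of \<theta> p a b "[]"]
  by (simp add: defect_def bsum_append bsum_Cons algebra_simps)

text \<open>Only the cut right after the unit survives, and it returns \<open>h\<close> of the whole
  word.\<close>

lemma defect_first_Nil:
  assumes "\<theta> [] = 1"
  shows "defect \<theta> h ([] # q) = 0"
proof -
  have "bsum \<theta> h [[]] q = 0"
    unfolding bsum_def
  proof (intro sum.neutral ballI)
    fix j assume "j \<in> {..<length q}"
    then have "take (Suc j) q \<noteq> []" by auto
    then show "bcum \<theta> ([[]] @ take (Suc j) q) * h (concat (drop (Suc j) q)) = 0"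
      using bcum_first_Nil[of \<theta> "take (Suc j) q"] assms by simp
  qed
  then show ?thesis
    by (simp add: defect_def bsum_Cons assms)
qed

lemma defect_Nil_after:
  assumes "\<theta> [] = 1"
  shows "defect \<theta> h (p @ a # [] # q) = defect \<theta> h (p @ a # q)"
  by (simp add: defect_merge defect_first_Nil assms)

text \<open>A vanishing interior entry lets its two neighbours, which lie in the same algebra, be merged.\<close>
lemma defect_empty_entry:
  assumes one: "\<theta> [] = 1"
    and even0: "\<And>c us. alt c us \<Longrightarrow> even (length us) \<Longrightarrow> bcum \<theta> us = 0"
    and IH: "\<And>vs. length vs < length us \<Longrightarrow> odd (length vs) \<Longrightarrow> alt c vs \<Longrightarrow> defect \<theta> h vs = 0"
    and us: "us = p @ [] # q" "q \<noteq> []" "odd (length us)" "alt c us"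
  shows "defect \<theta> h us = 0"
proof (cases p rule: rev_cases)
  case Nil
  then show ?thesis
    using us by (simp add: defect_first_Nil one)
next
  case (snoc p' a)
  obtain b q' where q: "q = b # q'"
    using us by (cases q) auto
  have "defect \<theta> h us = defect \<theta> h (p' @ (a @ b) # q') - bcum \<theta> (p' @ [a]) * defect \<theta> h (b # q')"
    using us snoc q defect_Nil_after[of \<theta> h p' a q] one defect_merge[of \<theta> h p' a b q']
    by simp
  moreover have "defect \<theta> h (p' @ (a @ b) # q') = 0"
    using us snoc q by (intro IH) (auto simp: alt_append split: if_splits)
  moreover have "bcum \<theta> (p' @ [a]) * defect \<theta> h (b # q') = 0"
  \<comment> \<open>An even prefix has zero cumulant. After an odd prefix, \<open>b # q'\<close> has
    odd length and starts in the algebra of \<open>c\<close>, so the induction hypothesis applies to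
    it.\<close>
  proof (cases "even (length (p' @ [a]))")
    case True
    then have "bcum \<theta> (p' @ [a]) = 0"
      using us snoc by (intro even0[of c]) (auto simp: alt_append split: if_splits)
    then show ?thesis by simp
  next
    case False
    then have "defect \<theta> h (b # q') = 0"
      using us snoc q by (intro IH) (auto simp: alt_append split: if_splits)
    then show ?thesis by simp
  qed
  ultimately show ?thesis by simp
qed

subsection \<open>Centring\<close>

text \<open>The value at \<open>(u\<^sub>1 - \<psi> u\<^sub>1, \<dots>, u\<^sub>n - \<psi> u\<^sub>n)\<close> of the multilinear extension of \<open>D\<close>.\<close>
fun cent :: "(word \<Rightarrow> complex) \<Rightarrow> (word list \<Rightarrow> complex) \<Rightarrow> word list \<Rightarrow> complex" where
  "cent \<psi> D [] = D []"
| "cent \<psi> D (u # us) = cent \<psi> (\<lambda>v. D (u # v)) us - \<psi> u * cent \<psi> (\<lambda>v. D ([] # v)) us"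

abbreviation sub_entries :: "word list \<Rightarrow> word list \<Rightarrow> bool" where
  "sub_entries \<equiv> list_all2 (\<lambda>v u. v = u \<or> v = [])"

lemma cent_cong:
  "(\<And>vs. sub_entries vs us \<Longrightarrow> D vs = D' vs) \<Longrightarrow> cent \<psi> D us = cent \<psi> D' us"
proof (induction us arbitrary: D D')
  case (Cons u us)
  have "cent \<psi> (\<lambda>v. D (u # v)) us = cent \<psi> (\<lambda>v. D' (u # v)) us"
    "cent \<psi> (\<lambda>v. D ([] # v)) us = cent \<psi> (\<lambda>v. D' ([] # v)) us"
    by (rule Cons.IH, rule Cons.prems, simp)+
  then show ?case by simp
qed simp

lemma cent_zero [simp]: "cent \<psi> (\<lambda>_. 0) us = 0"
  by (induction us) auto

lemma cent_add: "cent \<psi> (\<lambda>v. D v + D' v) us = cent \<psi> D us + cent \<psi> D' us"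
  by (induction us arbitrary: D D') (auto simp: algebra_simps)

lemma cent_cmult: "cent \<psi> (\<lambda>v. c * D v) us = c * cent \<psi> D us"
  by (induction us arbitrary: D) (auto simp: algebra_simps)

lemma cent_diff: "cent \<psi> (\<lambda>v. D v - D' v) us = cent \<psi> D us - cent \<psi> D' us"
  using cent_add[of \<psi> D "\<lambda>v. (-1) * D' v" us] cent_cmult[of \<psi> "-1" D' us] by simp

lemma cent_sum: "finite A \<Longrightarrow> cent \<psi> (\<lambda>v. \<Sum>j\<in>A. D j v) us = (\<Sum>j\<in>A. cent \<psi> (D j) us)"
  by (induction A rule: finite_induct) (auto simp: cent_add)

text \<open>A product of functions of disjoint groups of entries stays a product under multilinear
  extension.\<close>

lemma cent_take_drop:
  "cent \<psi> (\<lambda>v. f (take k v) * g (drop k v)) us = cent \<psi> f (take k us) * cent \<psi> g (drop k us)"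
proof (induction us arbitrary: k f)
  case (Cons u us)
  show ?case
    using Cons[of "\<lambda>v. f (u # v)"] Cons[of "\<lambda>v. f ([] # v)"]
    by (cases k) (auto simp: cent_cmult algebra_simps)
qed simp

text \<open>Centring unfolds from the front; unfolding it at the back compares a tuple whose last
  entry is kept with the fully centred one.\<close>

lemma cent_snoc:
  "cent \<psi> D (us @ [u]) = cent \<psi> (\<lambda>v. D (v @ [u])) us - \<psi> u * cent \<psi> (\<lambda>v. D (v @ [[]])) us"
proof (induction us arbitrary: D)
  case (Cons a us)
  show ?case
    using Cons[of "\<lambda>v. D (a # v)"] Cons[of "\<lambda>v. D ([] # v)"]
    by (simp add: right_diff_distrib)
qed simp

lemma cent_eq_self:
  "(\<And>vs. sub_entries vs us \<Longrightarrow> [] \<in> set vs \<Longrightarrow> D vs = 0) \<Longrightarrow> cent \<psi> D us = D us"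
proof (induction us arbitrary: D)
  case (Cons u us)
  have "cent \<psi> (\<lambda>v. D ([] # v)) us = cent \<psi> (\<lambda>_. 0) us"
    by (rule cent_cong) (auto intro: Cons.prems)
  moreover have "cent \<psi> (\<lambda>v. D (u # v)) us = D (u # us)"
    by (rule Cons.IH) (auto intro: Cons.prems)
  ultimately show ?case by simp
qed simp

lemma alt_sub_entries: "sub_entries vs us \<Longrightarrow> alt c us \<Longrightarrow> alt c vs"
  by (induction vs us arbitrary: c rule: list_all2_induct) auto

lemma cent_bsum:
  "cent \<psi> (bsum \<theta> h []) us =
    (\<Sum>j<length us. cent \<psi> (bcum \<theta>) (take (Suc j) us) * cent \<psi> (\<lambda>v. h (concat v)) (drop (Suc j) us))"
proof -
  \<comment> \<open>The range of summation depends on the tuple only through its length, which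
    replacing entries by the unit preserves.\<close>
  have "cent \<psi> (bsum \<theta> h []) us = cent \<psi> (\<lambda>v. \<Sum>j<length us.
      bcum \<theta> (take (Suc j) v) * h (concat (drop (Suc j) v))) us"
    by (rule cent_cong) (simp add: bsum_def list_all2_lengthD)
  also have "\<dots> = (\<Sum>j<length us. cent \<psi> (bcum \<theta>) (take (Suc j) us) *
      cent \<psi> (\<lambda>v. h (concat v)) (drop (Suc j) us))"
    by (simp add: cent_sum cent_take_drop[of _ "bcum \<theta>" _ "\<lambda>v. h (concat v)"])
  finally show ?thesis .
qed

subsection \<open>Noncommutative polynomials\<close>

lemma supp_mono: "finite A \<Longrightarrow> (\<And>w. P w \<noteq> 0 \<Longrightarrow> w \<in> A) \<Longrightarrow> is_poly P"
  unfolding is_poly_def by (rule finite_subset[of _ A]) auto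

text \<open>Supports can shrink under addition and scaling, so values of \<open>lin\<close> are
  compared on a common finite superset.\<close>

lemma lin_superset:
  assumes "finite A" "\<And>w. P w \<noteq> 0 \<Longrightarrow> w \<in> A"
  shows "lin \<theta> P = (\<Sum>w\<in>A. P w * \<theta> w)"
  unfolding lin_def by (rule sum.mono_neutral_left) (use assms in auto)

lemma is_poly_monom [simp]: "is_poly (monom w)"
  by (rule supp_mono[of "{w}"]) (auto simp: monom_def split: if_splits)

lemma is_poly_psmult [simp]: "is_poly P \<Longrightarrow> is_poly (c *s P)"
  unfolding is_poly_def by (erule rev_finite_subset) (auto simp: psmult_def)

lemma is_poly_add [simp]: "is_poly P \<Longrightarrow> is_poly Q \<Longrightarrow> is_poly (P + Q)"
  unfolding is_poly_def by (rule finite_subset[of _ "{w. P w \<noteq> 0} \<union> {w. Q w \<noteq> 0}"]) auto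

lemma is_poly_diff [simp]: "is_poly P \<Longrightarrow> is_poly Q \<Longrightarrow> is_poly (P - Q)"
  unfolding is_poly_def by (rule finite_subset[of _ "{w. P w \<noteq> 0} \<union> {w. Q w \<noteq> 0}"]) auto

lemma is_poly_0 [simp]: "is_poly 0"
  by (simp add: is_poly_def)

lemma is_poly_sum: "(\<And>i. i \<in> A \<Longrightarrow> is_poly (f i)) \<Longrightarrow> is_poly (sum f A)"
  by (induction A rule: infinite_finite_induct) auto

lemma is_poly_pone [simp]: "is_poly pone"
  by (simp add: pone_def)

lemma lin_0 [simp]: "lin \<theta> 0 = 0"
  by (simp add: lin_def)

lemma lin_add: "is_poly P \<Longrightarrow> is_poly Q \<Longrightarrow> lin \<theta> (P + Q) = lin \<theta> P + lin \<theta> Q"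
  by (subst (1 2 3) lin_superset[where A = "{w. P w \<noteq> 0} \<union> {w. Q w \<noteq> 0}"])
    (auto simp: is_poly_def sum.distrib algebra_simps)

lemma lin_diff: "is_poly P \<Longrightarrow> is_poly Q \<Longrightarrow> lin \<theta> (P - Q) = lin \<theta> P - lin \<theta> Q"
  by (subst (1 2 3) lin_superset[where A = "{w. P w \<noteq> 0} \<union> {w. Q w \<noteq> 0}"])
    (auto simp: is_poly_def sum_subtractf algebra_simps)

lemma lin_psmult: "is_poly P \<Longrightarrow> lin \<theta> (c *s P) = c * lin \<theta> P"
  by (subst (1 2) lin_superset[where A = "{w. P w \<noteq> 0}"])
    (auto simp: is_poly_def psmult_def sum_distrib_left algebra_simps)

lemma lin_sum: "(\<And>i. i \<in> A \<Longrightarrow> is_poly (f i)) \<Longrightarrow> lin \<theta> (sum f A) = (\<Sum>i\<in>A. lin \<theta> (f i))"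
  by (induction A rule: infinite_finite_induct) (auto simp: lin_add is_poly_sum)

lemma lin_monom [simp]: "lin \<theta> (monom w) = \<theta> w"
  by (subst lin_superset[where A = "{w}"]) (auto simp: monom_def split: if_splits)

lemma lin_pone [simp]: "lin \<theta> pone = \<theta> []"
  by (simp add: pone_def)

lemma monom_pmult:
  "pmult (monom u) P w = (if take (length u) w = u then P (drop (length u) w) else 0)"
proof -
  have "pmult (monom u) P w =
    (\<Sum>i\<le>length w. if i = length u \<and> take (length u) w = u then P (drop (length u) w) else 0)"
    unfolding pmult_def monom_def by (rule sum.cong) auto
  also have "\<dots> = (if take (length u) w = u then P (drop (length u) w) else 0)"
    using arg_cong[of "take (length u) w" u length] by (auto simp: sum.delta)
  finally show ?thesis .
qed

lemma pmult_monom: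
  "pmult P (monom u) w = (if length u \<le> length w \<and> drop (length w - length u) w = u
     then P (take (length w - length u) w) else 0)"
proof -
  have "pmult P (monom u) w =
    (\<Sum>i\<le>length w. if i = length w - length u then
      (if length u \<le> length w \<and> drop (length w - length u) w = u then P (take (length w - length u) w) else 0) else 0)"
    unfolding pmult_def monom_def by (rule sum.cong) auto
  also have "\<dots> = (if length u \<le> length w \<and> drop (length w - length u) w = u
     then P (take (length w - length u) w) else 0)"
    by (simp add: sum.delta)
  finally show ?thesis .
qed

lemma pmult_add_left: "pmult (P + Q) R = pmult P R + pmult Q R"
  by (auto simp: pmult_def sum.distrib algebra_simps fun_eq_iff)

lemma pmult_diff_left: "pmult (P - Q) R = pmult P R - pmult Q R"
  by (auto simp: pmult_def sum_subtractf algebra_simps fun_eq_iff)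

lemma pmult_psmult_left: "pmult (c *s P) R = c *s pmult P R"
  by (auto simp: pmult_def psmult_def sum_distrib_left algebra_simps fun_eq_iff)

lemma pmult_psmult_right: "pmult R (c *s P) = c *s pmult R P"
  by (auto simp: pmult_def psmult_def sum_distrib_left algebra_simps fun_eq_iff)

lemma pmult_0_left [simp]: "pmult 0 R = 0"
  by (auto simp: pmult_def fun_eq_iff)

lemma pmult_0_right [simp]: "pmult R 0 = 0"
  by (auto simp: pmult_def fun_eq_iff)

lemma pmult_add_right: "pmult R (P + Q) = pmult R P + pmult R Q"
  by (auto simp: pmult_def sum.distrib algebra_simps fun_eq_iff)

text \<open>From here on polynomials are handled as elements of a module; pointwise evaluation is
  invoked explicitly where it is wanted.\<close>

declare plus_fun_apply [simp del] zero_fun_apply [simp del] minus_apply [simp del]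

lemma pmult_sum_left: "pmult (sum f A) R = (\<Sum>i\<in>A. pmult (f i) R)"
  by (induction A rule: infinite_finite_induct) (auto simp: pmult_add_left)

lemma pmult_sum_right: "pmult R (sum f A) = (\<Sum>i\<in>A. pmult R (f i))"
  by (induction A rule: infinite_finite_induct) (auto simp: pmult_add_right)

lemma pmult_pone_left [simp]: "pmult pone P = P"
  by (auto simp: monom_pmult pone_def fun_eq_iff)

lemma pmult_pone_right [simp]: "pmult P pone = P"
  by (auto simp: pmult_monom pone_def fun_eq_iff)

lemma monom_pmult_monom [simp]: "pmult (monom u) (monom v) = monom (u @ v)"
proof
  fix w
  have "take (length u) w = u \<and> drop (length u) w = v \<longleftrightarrow> w = u @ v"
    by (metis append_eq_conv_conj)
  then show "pmult (monom u) (monom v) w = monom (u @ v) w"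
    unfolding monom_pmult unfolding monom_def by auto
qed

lemma is_poly_monom_pmult [simp]:
  assumes "is_poly P"
  shows "is_poly (pmult (monom u) P)"
proof (rule supp_mono[of "(@) u ` {w. P w \<noteq> 0}"])
  show "finite ((@) u ` {w. P w \<noteq> 0})"
    using assms by (simp add: is_poly_def)
next
  fix w assume "pmult (monom u) P w \<noteq> 0"
  then have "take (length u) w = u" "P (drop (length u) w) \<noteq> 0"
    by (auto simp: monom_pmult split: if_splits)
  then show "w \<in> (@) u ` {w. P w \<noteq> 0}"
    by (metis (mono_tags) append_take_drop_id image_eqI mem_Collect_eq)
qed

text \<open>A left factor moves into the functional. Inductions over products can therefore run with
  the functional generalised.\<close>

lemma lin_monom_pmult:
  assumes "is_poly P"
  shows "lin \<theta> (pmult (monom u) P) = lin (\<lambda>v. \<theta> (u @ v)) P"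
proof -
  have "lin \<theta> (pmult (monom u) P) = (\<Sum>w\<in>(@) u ` {w. P w \<noteq> 0}. pmult (monom u) P w * \<theta> w)"
  proof (rule lin_superset)
    show "finite ((@) u ` {w. P w \<noteq> 0})"
      using assms by (simp add: is_poly_def)
  next
    fix w assume "pmult (monom u) P w \<noteq> 0"
    then have "take (length u) w = u" "P (drop (length u) w) \<noteq> 0"
      by (auto simp: monom_pmult split: if_splits)
    then show "w \<in> (@) u ` {w. P w \<noteq> 0}"
      by (metis (mono_tags) append_take_drop_id image_eqI mem_Collect_eq)
  qed
  also have "\<dots> = lin (\<lambda>v. \<theta> (u @ v)) P"
    unfolding lin_def by (subst sum.reindex) (auto simp: inj_on_def monom_pmult)
  finally show ?thesis .
qed

subsection \<open>Consequences of c-freeness\<close>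

definition centred :: "(word \<Rightarrow> complex) \<Rightarrow> word \<Rightarrow> ncpoly" where
  "centred \<psi> u = monom u - \<psi> u *s pone"

lemma is_poly_prodl_centred: "is_poly (prodl (map (centred \<psi>) us))"
  by (induction us)
    (auto simp: prodl_def centred_def pmult_diff_left pmult_psmult_left)

text \<open>The bridge from the polynomials in the definition of c-freeness to the combinatorial
  centring of word tuples.\<close>

lemma lin_prodl_centred:
  "lin \<theta> (prodl (map (centred \<psi>) us)) = cent \<psi> (\<lambda>v. \<theta> (concat v)) us"
proof (induction us arbitrary: \<theta>)
  case (Cons u us)
  let ?P = "prodl (map (centred \<psi>) us)"
  have "prodl (map (centred \<psi>) (u # us)) = pmult (monom u) ?P - \<psi> u *s ?P"
    by (simp add: prodl_def centred_def pmult_diff_left pmult_psmult_left)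
  then show ?case
    using Cons[of "\<lambda>v. \<theta> (u @ v)"] Cons[of \<theta>] is_poly_prodl_centred[of \<psi> us]
    by (simp add: lin_diff lin_psmult lin_monom_pmult)
qed (simp add: prodl_def)

locale cfree_pair =
  fixes \<phi> \<psi> :: "word \<Rightarrow> complex"
  assumes unit_phi: "\<phi> [] = 1" and unit_psi: "\<psi> [] = 1"
    and cf: "cfree \<phi> \<psi>"
begin

lemma lin_centred: "lin \<theta> (centred \<psi> u) = \<theta> u - \<psi> u * \<theta> []"
  by (simp add: centred_def lin_diff lin_psmult)

lemma cent_moment:
  assumes "alt c us" "us \<noteq> []"
  shows "cent \<psi> (\<lambda>v. \<psi> (concat v)) us = 0"
    and "cent \<psi> (\<lambda>v. \<phi> (concat v)) us = (\<Prod>j<length us. \<phi> (us ! j) - \<psi> (us ! j))"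
proof -
  let ?us = "map (centred \<psi>) us"
  let ?s = "\<lambda>j::nat. if even j then c else other c"
  have *: "set (us ! j) \<subseteq> {?s j}" if "j < length us" for j
    using that assms(1)
  proof (induction us arbitrary: c j)
    case (Cons u us)
    show ?case
      using Cons.IH[of "j - 1" "other c"] Cons.prems by (cases j) auto
  qed simp
  have "in_alg (?s j) (?us ! j) \<and> lin \<psi> (?us ! j) = 0" if "j < length ?us" for j
  proof -
    have "is_poly (?us ! j)"
      using that by (simp add: centred_def)
    moreover have "set w \<subseteq> {?s j}" if "(?us ! j) w \<noteq> 0" for w
      using that \<open>j < length ?us\<close> *[of j]
      by (auto simp: centred_def monom_def pone_def psmult_def minus_apply split: if_splits)
    ultimately show ?thesis
      using that by (auto simp: in_alg_def lin_centred unit_psi)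
  qed
  moreover have "?s j \<noteq> ?s (Suc j)" for j
    by auto
  ultimately have "lin \<psi> (prodl ?us) = 0 \<and> lin \<phi> (prodl ?us) = (\<Prod>j<length ?us. lin \<phi> (?us ! j))"
    using assms(2) by (intro cf[unfolded cfree_def, rule_format, of ?us ?s]) auto
  then show "cent \<psi> (\<lambda>v. \<psi> (concat v)) us = 0"
    "cent \<psi> (\<lambda>v. \<phi> (concat v)) us = (\<Prod>j<length us. \<phi> (us ! j) - \<psi> (us ! j))"
    by (auto simp: lin_prodl_centred lin_centred unit_phi)
qed

text \<open>On centred tuples the \<phi>-moment is multiplicative, so the term with a first cumulant
  of length one already equals the whole moment. The intermediate terms vanish by induction, which
  leaves zero for the top cumulant.\<close>

lemma cent_bcum:
  assumes "alt c us" "2 \<le> length us"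
  shows "cent \<psi> (bcum \<phi>) us = 0"
  using assms
proof (induction "length us" arbitrary: us rule: less_induct)
  case less
  obtain a us' where us: "us = a # us'" "us' \<noteq> []"
    using less.prems by (cases us) (auto simp: Suc_le_eq)
  let ?m = "\<lambda>v. \<phi> (concat v)"
  have bs: "cent \<psi> (bsum \<phi> \<phi> []) us = cent \<psi> ?m us"
    using us by (intro cent_cong moment_bsum[symmetric] unit_phi) auto
  have "cent \<psi> (bcum \<phi>) (take (Suc j) us) * cent \<psi> ?m (drop (Suc j) us) = 0"
    if "j \<noteq> 0" "j < length us - 1" for j
  proof -
    have "cent \<psi> (bcum \<phi>) (take (Suc j) us) = 0"
      using that less.prems by (intro less.hyps alt_take) auto
    then show ?thesis by simp
  qed
  then have "(\<Sum>j<length us - 1. cent \<psi> (bcum \<phi>) (take (Suc j) us) * cent \<psi> ?m (drop (Suc j) us)) =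
    (\<Sum>j\<in>{0}. cent \<psi> (bcum \<phi>) (take (Suc j) us) * cent \<psi> ?m (drop (Suc j) us))"
    using us by (intro sum.mono_neutral_right) auto
  also have "\<dots> = cent \<psi> (bcum \<phi>) [a] * cent \<psi> ?m us'"
    using us by simp
  also have "\<dots> = cent \<psi> ?m us"
    using cent_moment(2)[of c us] cent_moment(2)[of "other c" us'] less.prems us
    by (simp add: unit_phi prod.lessThan_Suc_shift del: prod.lessThan_Suc)
  finally have *: "(\<Sum>j<length us - 1. cent \<psi> (bcum \<phi>) (take (Suc j) us) * cent \<psi> ?m (drop (Suc j) us))
    = cent \<psi> ?m us" .
  have "length us = Suc (length us - 1)"
    using us by simp
  then have "cent \<psi> (bsum \<phi> \<phi> []) us = (\<Sum>j<length us - 1. cent \<psi> (bcum \<phi>) (take (Suc j) us) *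
      cent \<psi> ?m (drop (Suc j) us)) + cent \<psi> (bcum \<phi>) us"
    unfolding cent_bsum using sum.lessThan_Suc[of "\<lambda>j. cent \<psi> (bcum \<phi>) (take (Suc j) us) *
      cent \<psi> ?m (drop (Suc j) us)" "length us - 1"] by (simp add: unit_phi)
  with * bs show ?case by simp
qed

lemma bcum_even:
  assumes "alt c us" "even (length us)"
  shows "bcum \<phi> us = 0"
  using assms
proof (induction "length us" arbitrary: us c rule: less_induct)
  case less
  show ?case
  proof (cases "us = []")
    case False
    then have len: "2 \<le> length us"
      using less.prems by (cases us; cases "tl us") auto
    have "cent \<psi> (bcum \<phi>) us = bcum \<phi> us"
    proof (rule cent_eq_self)
      fix vs assume vs: "sub_entries vs us" and "[] \<in> set vs"
      have lvs: "length vs = length us"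
        using vs by (simp add: list_all2_lengthD)
      have alt: "alt c vs"
        using alt_sub_entries less.prems vs by blast
      obtain p q where pq: "vs = p @ [] # q"
        using \<open>[] \<in> set vs\<close> by (meson split_list)
      show "bcum \<phi> vs = 0"
      proof (cases "p = [] \<or> q = []")
        case True
        with pq len lvs show ?thesis
          by (auto intro!: bcum_first_Nil bcum_last_Nil unit_phi)
      next
        case False
        then obtain p' a b q' where p: "p = p' @ [a]" and q: "q = b # q'"
          by (metis neq_Nil_conv rev_exhaust)
        have par: "odd (length p' + length q')"
          using lvs less.prems unfolding pq p q by simp presburger
        have "bcum \<phi> (p' @ a # [] # b # q') = bcum \<phi> (p' @ a # b # q')"
          using bcum_merge[of \<phi> p' a "[]" "b # q'"] by (simp add: bcum_first_Nil unit_phi)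
        also have "\<dots> = bcum \<phi> (p' @ (a @ b) # q') - bcum \<phi> (p' @ [a]) * bcum \<phi> (b # q')"
          by (simp add: bcum_merge)
        also have "bcum \<phi> (p' @ (a @ b) # q') = 0"
          using alt lvs par unfolding pq p q
          by (intro less.hyps[of _ c]) (auto simp: alt_append split: if_splits)
        also have "bcum \<phi> (p' @ [a]) * bcum \<phi> (b # q') = 0"
        \<comment> \<open>The lengths of the two tuples add up to an odd number, so exactly one of
          them is even and its cumulant vanishes by induction.\<close>
        proof (cases "even (length (p' @ [a]))")
          case True
          then have "bcum \<phi> (p' @ [a]) = 0"
            using alt lvs par unfolding pq p q
            by (intro less.hyps[of _ c]) (auto simp: alt_append split: if_splits)
          then show ?thesis by simp
        next
          case False
          then have "bcum \<phi> (b # q') = 0"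
            using alt lvs par unfolding pq p q
            by (intro less.hyps[of _ c]) (auto simp: alt_append split: if_splits)
          then show ?thesis by simp
        qed
        finally show ?thesis
          by (simp add: pq p q)
      qed
    qed
    moreover have "cent \<psi> (bcum \<phi>) us = 0"
      using len less.prems by (intro cent_bcum)
    ultimately show ?thesis by simp
  qed simp
qed

text \<open>For \<phi> = \<psi> the product of centred values is zero, so the condition reduces to
  freeness under \<psi>. Every result of the locale thereby becomes available for \<psi> as
  well.\<close>

lemma cfree_pair_psi: "cfree_pair \<psi> \<psi>"
proof
  show "cfree \<psi> \<psi>"
    unfolding cfree_def
  proof (intro allI impI)
    fix us :: "ncpoly list" and s :: "nat \<Rightarrow> letter"
    assume *: "us \<noteq> [] \<and> (\<forall>j<length us. in_alg (s j) (us ! j) \<and> lin \<psi> (us ! j) = 0) \<and>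
      (\<forall>j. Suc j < length us \<longrightarrow> s j \<noteq> s (Suc j))"
    then have "lin \<psi> (prodl us) = 0"
      using cf unfolding cfree_def by blast
    moreover have "(\<Prod>j<length us. lin \<psi> (us ! j)) = 0"
      using * by (intro prod_zero) auto
    ultimately show "lin \<psi> (prodl us) = 0 \<and> lin \<psi> (prodl us) = (\<Prod>j<length us. lin \<psi> (us ! j))"
      by simp
  qed
qed (rule unit_psi)+

text \<open>For \<psi> length one is included, because centring subtracts exactly the
  \<psi>-mean.\<close>

lemma cent_bcum_psi:
  assumes "alt c us" "us \<noteq> []"
  shows "cent \<psi> (bcum \<psi>) us = 0"
proof (cases "2 \<le> length us")
  case True
  then show ?thesis
    using cfree_pair.cent_bcum[OF cfree_pair_psi assms(1)] by simp
next
  case False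
  then obtain u where "us = [u]"
    using assms by (cases us; cases "tl us") auto
  then show ?thesis
    by (simp add: unit_psi)
qed

end

text \<open>Both sides read the coefficient of \<open>P\<close> at the middle part of
  \<open>w\<close>. Words too short to contain \<open>x\<close> and \<open>u\<close> without overlap
  are treated separately, and there both sides are zero.\<close>

lemma pmult_monoms_assoc:
  "pmult (pmult (monom x) P) (monom u) = pmult (monom x) (pmult P (monom u))"
proof
  fix w :: word
  show "pmult (pmult (monom x) P) (monom u) w = pmult (monom x) (pmult P (monom u)) w"
  proof (cases "length x + length u \<le> length w")
    case True
    define a b c where "a = take (length x) w"
      and "b = drop (length x) (take (length w - length u) w)"
      and "c = drop (length w - length u) w"
    have "length x \<le> length w - length u"
      using True by simp
    then have w: "w = a @ b @ c"
      unfolding a_def b_def c_def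
      by (metis append_assoc append_take_drop_id min.absorb1 take_take)
    have "length a = length x" "length c = length u"
      using True by (auto simp: a_def c_def)
    then show ?thesis
      unfolding w by (simp add: monom_pmult pmult_monom)
  next
    case False
    then have "take (length x) (take (length w - length u) w) \<noteq> x" if "length u \<le> length w"
      using that arg_cong[of "take (length x) (take (length w - length u) w)" x length] by auto
    then have "pmult (pmult (monom x) P) (monom u) w = 0"
      unfolding pmult_monom[of _ u w] monom_pmult by auto
    moreover have "pmult (monom x) (pmult P (monom u)) w = 0"
      using False unfolding monom_pmult pmult_monom[of _ u] by auto
    ultimately show ?thesis by simp
  qed
qed

subsection \<open>The conditional expectation of \<open>\<psi>\<close>\<close>

text \<open>The summand of \<open>EpsiX\<close> belonging to one chain of indices, rearranged to
  recurse along the chain.\<close>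

fun index_weight :: "(word \<Rightarrow> complex) \<Rightarrow> word list \<Rightarrow> nat list \<Rightarrow> ncpoly" where
  "index_weight \<psi> p [] = 0"
| "index_weight \<psi> p [i] = monom (p ! (2 * i))"
| "index_weight \<psi> p (i # j # r) =
     bcum \<psi> (seg p i j) *s pmult (monom (p ! (2 * i))) (index_weight \<psi> p (j # r))"

lemma psmult_psmult [simp]: "a *s b *s P = (a * b) *s P"
  by (simp add: psmult_def algebra_simps)

lemma psmult_0 [simp]: "c *s 0 = 0" "0 *s P = 0"
  by (simp_all add: psmult_def fun_eq_iff zero_fun_apply)

lemma psmult_add: "c *s (P + Q) = c *s P + c *s Q"
  by (simp add: psmult_def fun_eq_iff plus_fun_apply algebra_simps)

lemma psmult_sum: "c *s sum f A = (\<Sum>i\<in>A. c *s f i)"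
  by (induction A rule: infinite_finite_induct) (simp_all add: psmult_add)

lemma monom_append_pmult: "pmult (monom (u @ x)) P = pmult (monom u) (pmult (monom x) P)"
proof
  fix w
  have "take (length u + length x) w = u @ x \<longleftrightarrow>
      take (length u) w = u \<and> take (length x) (drop (length u) w) = x"
  proof
    assume *: "take (length u + length x) w = u @ x"
    have "length (take (length u + length x) w) = length u + length x"
      by (simp only: * length_append)
    then have "length u + length x \<le> length w"
      by simp
    with * show "take (length u) w = u \<and> take (length x) (drop (length u) w) = x"
      by (simp add: take_add)
  qed (simp add: take_add)
  then show "pmult (monom (u @ x)) P w = pmult (monom u) (pmult (monom x) P) w"
    by (simp add: monom_pmult add.commute)
qed

lemma index_weight_eq:
  "idx \<noteq> [] \<Longrightarrow> (\<Prod>j<length idx - 1. bcum \<psi> (seg p (idx ! j) (idx ! Suc j)))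
     *s monom (concat (map (\<lambda>i. p ! (2 * i)) idx)) = index_weight \<psi> p idx"
proof (induction \<psi> p idx rule: index_weight.induct)
  case (3 \<psi> p i j r)
  show ?case
    by (simp add: "3.IH"[symmetric] prod.lessThan_Suc_shift pmult_psmult_right del: prod.lessThan_Suc)
qed (auto simp: psmult_def)

text \<open>E^psi_X on a padded block list, organised by the first chain index m = i_1 after 0. The
  odd-length tuple (Y_1, X_1, ..., Y_m) enters the cumulant and the rest starts again at X_m. The
  case m = n leaves X_n alone.\<close>

function block_expect :: "(word \<Rightarrow> complex) \<Rightarrow> word list \<Rightarrow> ncpoly" where
  "block_expect \<psi> p = (if length p \<le> 1 then monom (hd p) else
     (\<Sum>m\<in>{1..length p div 2}. bcum \<psi> (take (2 * m - 1) (tl p))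
        *s pmult (monom (hd p)) (block_expect \<psi> (drop (2 * m) p))))"
  by auto
termination by (relation "measure (\<lambda>(\<psi>, p). length p)") auto

declare block_expect.simps [simp del]

lemma sorted_list_of_set_insert_least:
  "finite S \<Longrightarrow> (\<And>s. s \<in> S \<Longrightarrow> a < s) \<Longrightarrow>
    sorted_list_of_set (insert a S) = a # sorted_list_of_set (S :: nat set)"
  by (subst sorted_list_of_set_insert) (auto intro!: insort_is_Cons less_imp_le)

text \<open>The subsets are split by whether they contain \<open>a\<close>. If they do,
  \<open>a\<close> is the least element, hence the next index after \<open>i\<close>, and the
  cumulant between the two factors out.\<close>

lemma sum_index_weight_step:
  assumes "i < a" "a < n"
  shows "(\<Sum>S\<in>Pow {a..<n}. index_weight \<psi> p (i # sorted_list_of_set S @ [n])) =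
    (\<Sum>S\<in>Pow {Suc a..<n}. index_weight \<psi> p (i # sorted_list_of_set S @ [n])) +
    bcum \<psi> (seg p i a) *s pmult (monom (p ! (2 * i)))
      (\<Sum>S\<in>Pow {Suc a..<n}. index_weight \<psi> p (a # sorted_list_of_set S @ [n]))"
proof -
  have P: "Pow {a..<n} = Pow {Suc a..<n} \<union> insert a ` Pow {Suc a..<n}"
  proof -
    have "{a..<n} = insert a {Suc a..<n}"
      using assms by auto
    then show ?thesis
      by (simp add: Pow_insert)
  qed
  have inj: "inj_on (insert a) (Pow {Suc a..<n})"
    by (auto simp: inj_on_def) (metis Pow_iff Suc_n_not_le_n atLeastLessThan_iff insert_ident subsetD)+
  have "(\<Sum>S\<in>insert a ` Pow {Suc a..<n}. index_weight \<psi> p (i # sorted_list_of_set S @ [n])) =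
    (\<Sum>S\<in>Pow {Suc a..<n}. bcum \<psi> (seg p i a) *s pmult (monom (p ! (2 * i)))
      (index_weight \<psi> p (a # sorted_list_of_set S @ [n])))"
    unfolding sum.reindex[OF inj]
  proof (rule sum.cong)
    fix S assume "S \<in> Pow {Suc a..<n}"
    then have "sorted_list_of_set (insert a S) = a # sorted_list_of_set S"
      by (intro sorted_list_of_set_insert_least) (auto intro: finite_subset)
    then show "((\<lambda>S. index_weight \<psi> p (i # sorted_list_of_set S @ [n])) \<circ> insert a) S =
      bcum \<psi> (seg p i a) *s pmult (monom (p ! (2 * i))) (index_weight \<psi> p (a # sorted_list_of_set S @ [n]))"
      by simp
  qed simp
  also have "\<dots> = bcum \<psi> (seg p i a) *s pmult (monom (p ! (2 * i)))
      (\<Sum>S\<in>Pow {Suc a..<n}. index_weight \<psi> p (a # sorted_list_of_set S @ [n]))"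
    by (simp add: pmult_sum_right psmult_sum)
  finally show ?thesis
    unfolding P by (subst sum.union_disjoint) auto
qed

text \<open>The outer induction handles the chain beyond the next index. The inner one lowers a
  bound \<open>a\<close> on that index and peels off one possible value at a time.\<close>

lemma sum_index_weight:
  assumes "length p = Suc (2 * n)" "i < n"
  shows "(\<Sum>S\<in>Pow {Suc i..<n}. index_weight \<psi> p (i # sorted_list_of_set S @ [n])) =
    block_expect \<psi> (drop (2 * i) p)"
  using assms(2)
proof (induction "n - i" arbitrary: i rule: less_induct)
  case less
  let ?t = "\<lambda>m. bcum \<psi> (seg p i m) *s pmult (monom (p ! (2 * i))) (block_expect \<psi> (drop (2 * m) p))"
  have "(\<Sum>S\<in>Pow {a..<n}. index_weight \<psi> p (i # sorted_list_of_set S @ [n])) = (\<Sum>m\<in>{a..n}. ?t m)"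
    if "i < a" "a \<le> n" for a
    using that(2,1)
  proof (induction a rule: inc_induct)
    \<comment> \<open>No interior index is left: the chain jumps from \<open>i\<close> to
      \<open>n\<close>, and the remaining list is the last block.\<close>
    case base
    then show ?case
      using assms by (simp add: block_expect.simps hd_drop_conv_nth)
  next
    case (step a)
    then have "(\<Sum>S\<in>Pow {Suc a..<n}. index_weight \<psi> p (a # sorted_list_of_set S @ [n])) =
        block_expect \<psi> (drop (2 * a) p)"
      by (intro less.hyps) auto
    then show ?case
      using step by (simp add: sum_index_weight_step sum.atLeast_Suc_atMost[of a n] add.commute)
  qed
  from this[of "Suc i"] less.prems
  have "(\<Sum>S\<in>Pow {Suc i..<n}. index_weight \<psi> p (i # sorted_list_of_set S @ [n])) = (\<Sum>m\<in>{Suc i..n}. ?t m)"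
    by simp
  also have "\<dots> = (\<Sum>m\<in>{1..n - i}. bcum \<psi> (take (2 * m - 1) (tl (drop (2 * i) p)))
        *s pmult (monom (hd (drop (2 * i) p))) (block_expect \<psi> (drop (2 * m) (drop (2 * i) p))))"
  proof (rule sum.reindex_bij_witness[of _ "\<lambda>m. m + i" "\<lambda>m. m - i"])
    fix m assume m: "m \<in> {Suc i..n}"
    have "seg p i m = take (2 * (m - i) - 1) (tl (drop (2 * i) p))"
      by (simp add: seg_def drop_Suc tl_drop diff_mult_distrib2 algebra_simps)
    then show "bcum \<psi> (take (2 * (m - i) - 1) (tl (drop (2 * i) p)))
        *s pmult (monom (hd (drop (2 * i) p))) (block_expect \<psi> (drop (2 * (m - i)) (drop (2 * i) p))) = ?t m"
      using m assms less.prems by (simp add: hd_drop_conv_nth diff_mult_distrib2)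
  qed auto
  also have "\<dots> = block_expect \<psi> (drop (2 * i) p)"
  proof -
    have "length (drop (2 * i) p) div 2 = n - i" "\<not> length (drop (2 * i) p) \<le> 1"
      using assms less.prems by auto
    then show ?thesis
      by (subst block_expect.simps[of _ "drop (2 * i) p"]) (simp only: if_False)
  qed
  finally show ?case .
qed

text \<open>The shape of \<open>pad W\<close>.\<close>
definition padded :: "word list \<Rightarrow> bool" where
  "padded p \<longleftrightarrow> alt LX p \<and> odd (length p) \<and> [] \<notin> set (butlast (tl p))"

lemma blocks_append:
  assumes "u \<noteq> []" "set u \<subseteq> {c}" "blocks w = [] \<or> hd (hd (blocks w)) \<noteq> c"
  shows "blocks (u @ w) = u # blocks w"
  using assms
proof (induction u)
  case (Cons a u)
  show ?case
  proof (cases "u = []")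
    case True
    then show ?thesis
      using Cons.prems by (auto split: list.splits)
  next
    case False
    then have "hd u = a"
      using Cons.prems by (cases u) auto
    then show ?thesis
      using Cons False by simp
  qed
qed simp

lemma blocks_concat: "alt c us \<Longrightarrow> [] \<notin> set us \<Longrightarrow> blocks (concat us) = us"
proof (induction us arbitrary: c)
  case (Cons u us)
  have "us = [] \<or> hd (hd us) \<noteq> c"
    using Cons.prems by (cases us; cases "hd us") auto
  then show ?case
    using Cons blocks_append[of u c "concat us"] by auto
qed simp

text \<open>Uniqueness of the block form: it allows \<open>EpsiX\<close> to be computed from any
  padded list at hand.\<close>

lemma pad_concat:
  assumes "padded p"
  shows "pad (concat p) = p"
proof -
  obtain x q where p: "p = x # q"
    using assms by (cases p) (auto simp: padded_def)
  show ?thesis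
  proof (cases q rule: rev_cases)
    case Nil
    then have "blocks x = (if x = [] then [] else [x])" "x \<noteq> [] \<Longrightarrow> hd x = LX"
      using assms p blocks_concat[of LX "[x]"] by (auto simp: padded_def) (cases x; auto)
    then show ?thesis
      by (simp add: p Nil pad_def)
  next
    case (snoc vs z)
    have alt: "alt LY vs" "set x \<subseteq> {LX}" "set z \<subseteq> {LX}" "odd (length vs)" and ne: "[] \<notin> set vs"
      using assms p snoc by (auto simp: padded_def alt_append)
    have vs: "vs \<noteq> []"
      using alt by auto
    have hd_vs: "hd (hd vs) = LY"
      using alt ne vs by (cases vs; cases "hd vs") auto
    have last_vs: "last vs \<noteq> []" "hd (last vs) = LY"
      using alt ne vs by (cases vs rule: rev_cases; cases "last vs"; auto simp: alt_append split: if_splits)+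
    have hdz: "z \<noteq> [] \<Longrightarrow> hd z = LX" and hdx: "x \<noteq> [] \<Longrightarrow> hd x = LX"
      using alt by (cases z; auto; fail) (use alt in \<open>cases x; auto\<close>)
    have vz: "blocks (concat vs @ z) = vs @ (if z = [] then [] else [z])"
      using blocks_concat[of LY "vs @ (if z = [] then [] else [z])"] alt ne by (auto simp: alt_append)
    have "blocks (x @ concat vs @ z) = (if x = [] then [] else [x]) @ vs @ (if z = [] then [] else [z])"
      using blocks_append[of x LX "concat vs @ z"] alt vz hd_vs vs by auto
    then show ?thesis
      using hdx hdz hd_vs last_vs vs unfolding p snoc pad_def
      by (auto simp: Let_def)
  qed
qed

lemma padded_exists: "\<exists>p. padded p \<and> concat p = W"
proof (induction W)
  case Nil
  show ?case
    by (intro exI[of _ "[[]]"]) (simp add: padded_def)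
next
  case (Cons a W)
  then obtain p where p: "padded p" "concat p = W"
    by blast
  obtain x q where xq: "p = x # q"
    using p by (cases p) (auto simp: padded_def)
  show ?case
  proof (cases a)
    case LX
    then show ?thesis
      using p xq by (intro exI[of _ "(LX # x) # q"]) (auto simp: padded_def)
  next
    case LY
    show ?thesis
    \<comment> \<open>A leading Y extends the first Y-block if no X-block precedes it. Otherwise it
      opens a new block, and then \<open>x\<close> either is nonempty or is the final entry, which
      may be empty.\<close>
    proof (cases "x = [] \<and> q \<noteq> []")
      case True
      then obtain y q' where "q = y # q'" "q' \<noteq> []"
        using p xq by (cases q; cases "tl q") (auto simp: padded_def)
      then show ?thesis
        using p xq True LY by (intro exI[of _ "[] # (LY # y) # q'"]) (auto simp: padded_def)
    next
      case False
      then show ?thesis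
        using p xq LY by (intro exI[of _ "[] # [LY] # p"]) (cases q; auto simp: padded_def)
    qed
  qed
qed

text \<open>Trades the sum over subsets for the recursion; every later fact about
  \<open>EpsiX\<close> goes through it.\<close>

lemma EpsiX_concat:
  assumes "padded p"
  shows "EpsiX \<psi> (concat p) = block_expect \<psi> p"
proof (cases "length p \<le> 1")
  case True
  then obtain x where "p = [x]"
    using assms by (cases p) (auto simp: padded_def)
  then show ?thesis
    using pad_concat[OF assms] by (simp add: EpsiX_def block_expect.simps)
next
  case False
  define n where "n = length p div 2"
  have n: "length p = Suc (2 * n)" "0 < n"
    using assms False by (auto simp: n_def padded_def)
  have "EpsiX \<psi> (concat p) = (\<Sum>S\<in>Pow {1..n-1}. index_weight \<psi> p (0 # sorted_list_of_set S @ [n]))"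
    unfolding EpsiX_def pad_concat[OF assms] Let_def n_def[symmetric]
    using n by (simp only: index_weight_eq list.distinct if_False not_gr_zero[symmetric] not_not simp_thms)
  also have "{1..n-1} = {Suc 0..<n}"
    using n by auto
  finally show ?thesis
    using sum_index_weight[OF n] by simp
qed

lemma block_expect_Cons:
  assumes "odd (length q)"
  shows "block_expect \<psi> (x # q @ [z]) = (\<Sum>m\<in>{1..Suc (length q div 2)}.
    bcum \<psi> (take (2 * m - 1) q) *s pmult (monom x) (block_expect \<psi> (drop (2 * m - 1) q @ [z])))"
proof -
  have len: "length (x # q @ [z]) div 2 = Suc (length q div 2)" "\<not> length (x # q @ [z]) \<le> 1"
    by simp_all
  show ?thesis
    unfolding block_expect.simps[of _ "x # q @ [z]"] len(1) if_not_P[OF len(2)]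
  proof (rule sum.cong)
    fix m assume "m \<in> {1..Suc (length q div 2)}"
    then obtain k where "m = Suc k" "2 * k + 1 \<le> length q"
      using assms by (cases m) (auto elim!: oddE)
    then show "bcum \<psi> (take (2 * m - 1) (tl (x # q @ [z]))) *s
        pmult (monom (hd (x # q @ [z]))) (block_expect \<psi> (drop (2 * m) (x # q @ [z]))) =
      bcum \<psi> (take (2 * m - 1) q) *s pmult (monom x) (block_expect \<psi> (drop (2 * m - 1) q @ [z]))"
      by simp
  qed simp
qed

lemma EpsiX_Nil [simp]: "EpsiX \<psi> [] = pone"
  using EpsiX_concat[of "[[]]"] by (simp add: padded_def block_expect.simps pone_def)

lemma EpsiX_pure: "set x \<subseteq> {LX} \<Longrightarrow> EpsiX \<psi> x = monom x"
  using EpsiX_concat[of "[x]"] by (simp add: padded_def block_expect.simps)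

lemma block_expect_head: "block_expect \<psi> ((u @ x) # q) = pmult (monom u) (block_expect \<psi> (x # q))"
  by (subst (1 2) block_expect.simps)
    (auto simp: pmult_sum_right pmult_psmult_right monom_append_pmult drop_Cons' intro!: sum.cong)

lemma EpsiX_append:
  assumes "set u \<subseteq> {LX}"
  shows "EpsiX \<psi> (u @ W) = pmult (monom u) (EpsiX \<psi> W)"
proof -
  obtain p where p: "padded p" "concat p = W"
    using padded_exists by blast
  obtain x q where xq: "p = x # q"
    using p by (cases p) (auto simp: padded_def)
  then have "padded ((u @ x) # q)"
    using p assms by (auto simp: padded_def)
  then have "EpsiX \<psi> (concat ((u @ x) # q)) = pmult (monom u) (block_expect \<psi> (x # q))"
    by (simp only: EpsiX_concat block_expect_head)
  then show ?thesis
    using EpsiX_concat[OF p(1)] p xq by auto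
qed

text \<open>The last entry sits in an X-position, so it enters each summand only as the final right
  factor and never lies inside a cumulant.\<close>

lemma block_expect_snoc:
  "even (length p) \<Longrightarrow> block_expect \<psi> (p @ [z @ u]) = pmult (block_expect \<psi> (p @ [z])) (monom u)"
proof (induction "length p" arbitrary: p rule: less_induct)
  case less
  show ?case
  proof (cases p)
    case Nil
    then show ?thesis
      by (simp add: block_expect.simps)
  next
    case (Cons x q)
    then have "odd (length q)"
      using less.prems by simp
    moreover have "block_expect \<psi> (drop (2 * m - 1) q @ [z @ u]) =
        pmult (block_expect \<psi> (drop (2 * m - 1) q @ [z])) (monom u)"
      if "m \<in> {1..Suc (length q div 2)}" for m
      using that Cons \<open>odd (length q)\<close> by (intro less.hyps) auto
    ultimately show ?thesis
      using Cons by (simp add: block_expect_Cons pmult_sum_left pmult_psmult_left pmult_monoms_assoc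
          del: sum.cl_ivl_Suc)
  qed
qed

lemma EpsiX_append_right:
  assumes "set u \<subseteq> {LX}"
  shows "EpsiX \<psi> (W @ u) = pmult (EpsiX \<psi> W) (monom u)"
proof -
  obtain p where p: "padded p" "concat p = W"
    using padded_exists by blast
  then obtain q z where qz: "p = q @ [z]"
    by (cases p rule: rev_cases) (auto simp: padded_def)
  then have "padded (q @ [z @ u])"
    using p assms by (cases q) (auto simp: padded_def alt_append split: if_splits)
  moreover have "even (length q)"
    using p qz by (simp add: padded_def)
  ultimately have "EpsiX \<psi> (concat (q @ [z @ u])) = pmult (block_expect \<psi> (q @ [z])) (monom u)"
    by (simp only: EpsiX_concat block_expect_snoc)
  then show ?thesis
    using EpsiX_concat[OF p(1)] p qz by auto
qed

section \<open>Membership in the subalgebra generated by one letter\<close>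

lemma in_alg_add: "in_alg c P \<Longrightarrow> in_alg c Q \<Longrightarrow> in_alg c (P + Q)"
  by (auto simp: in_alg_def plus_fun_apply) (metis add.left_neutral singletonD subsetD)

lemma in_alg_diff: "in_alg c P \<Longrightarrow> in_alg c Q \<Longrightarrow> in_alg c (P - Q)"
  by (auto simp: in_alg_def minus_apply) (metis diff_0 neg_equal_0_iff_equal singletonD subsetD)

lemma in_alg_psmult: "in_alg c P \<Longrightarrow> in_alg c (a *s P)"
  by (auto simp: in_alg_def psmult_def is_poly_psmult[unfolded psmult_def])

lemma in_alg_0 [simp]: "in_alg c 0"
  by (simp add: in_alg_def zero_fun_apply)

lemma in_alg_sum: "(\<And>i. i \<in> A \<Longrightarrow> in_alg c (f i)) \<Longrightarrow> in_alg c (sum f A)"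
  by (induction A rule: infinite_finite_induct) (auto intro: in_alg_add)

lemma in_alg_monom: "set w \<subseteq> {c} \<Longrightarrow> in_alg c (monom w)"
  by (auto simp: in_alg_def) (auto simp: monom_def split: if_splits)

lemma in_alg_pone [simp]: "in_alg c pone"
  by (simp add: pone_def in_alg_monom)

lemma in_alg_monom_pmult:
  assumes "set u \<subseteq> {c}" "in_alg c P"
  shows "in_alg c (pmult (monom u) P)"
proof -
  have "set w \<subseteq> {c}" if "pmult (monom u) P w \<noteq> 0" for w
  proof -
    have "take (length u) w = u" "set (drop (length u) w) \<subseteq> {c}"
      using that assms by (auto simp: monom_pmult in_alg_def split: if_splits)
    then show ?thesis
      using assms by (metis Un_least append_take_drop_id set_append)
  qed
  then show ?thesis
    using assms by (simp add: in_alg_def)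
qed

lemma in_alg_block_expect: "alt LX p \<Longrightarrow> odd (length p) \<Longrightarrow> in_alg LX (block_expect \<psi> p)"
proof (induction "length p" arbitrary: p rule: less_induct)
  case less
  have hd: "set (hd p) \<subseteq> {LX}"
    using less.prems by (cases p) auto
  have "in_alg LX (block_expect \<psi> (drop (2 * m) p))" if "m \<in> {1..length p div 2}" for m
  proof (rule less.hyps)
    show "alt LX (drop (2 * m) p)"
      using less.prems alt_append[of LX "take (2 * m) p" "drop (2 * m) p"] that by auto
  qed (use that less.prems in auto)
  then show ?case
    using hd by (subst block_expect.simps)
      (auto intro!: in_alg_sum in_alg_psmult in_alg_monom_pmult in_alg_monom)
qed

lemma in_alg_EpsiX: "in_alg LX (EpsiX \<psi> W)"
proof -
  obtain p where "padded p" "concat p = W"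
    using padded_exists by blast
  then show ?thesis
    using EpsiX_concat[of p \<psi>] in_alg_block_expect[of p \<psi>] by (auto simp: padded_def)
qed

lemma is_poly_EpsiX [simp]: "is_poly (EpsiX \<psi> W)"
  using in_alg_EpsiX by (simp add: in_alg_def)

text \<open>Index j stands for a cumulant of length j + 1; the even j = 2m - 2 are the odd lengths
  2m - 1 that occur in \<open>block_expect\<close>.\<close>

lemma sum_even_indices:
  fixes f :: "nat \<Rightarrow> 'a :: comm_monoid_add"
  assumes "\<And>j. odd j \<Longrightarrow> f j = 0"
  shows "(\<Sum>j<Suc (2 * n). f j) = (\<Sum>m\<in>{1..Suc n}. f (2 * m - 2))"
  using assms by (induction n) auto

section \<open>Boolean recursions satisfied by E^psi_X under c-freeness\<close>

context cfree_pair
begin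

interpretation psi: cfree_pair \<psi> \<psi>
  by (rule cfree_pair_psi)

text \<open>With X_0 = 1, the recursion of \<open>block_expect\<close> is the odd part of the
  Boolean recursion with \<psi>-cumulants. The even part may be added because even cumulants of
  \<psi> vanish.\<close>

lemma EpsiX_expand:
  assumes vs: "alt LY vs" "odd (length vs)" "[] \<notin> set vs" and x: "set x \<subseteq> {LX}"
  shows "EpsiX \<psi> (concat vs @ x) =
    (\<Sum>j<length vs. bcum \<psi> (take (Suc j) vs) *s EpsiX \<psi> (concat (drop (Suc j) vs) @ x))"
proof -
  let ?f = "\<lambda>j. bcum \<psi> (take (Suc j) vs) *s EpsiX \<psi> (concat (drop (Suc j) vs) @ x)"
  have pad: "padded ([] # vs @ [x])"
    using assms by (simp add: padded_def alt_append)
  have E: "EpsiX \<psi> (concat (drop (2 * m - 1) vs) @ x) = block_expect \<psi> (drop (2 * m - 1) vs @ [x])"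
    if "m \<in> {1..Suc (length vs div 2)}" for m
  proof -
    have len: "2 * m - 1 \<le> length vs" "odd (2 * m - 1)"
      using that vs(2) by (auto elim!: oddE)
    have "alt LY (take (2 * m - 1) vs @ drop (2 * m - 1) vs)"
      using vs by simp
    then have "alt LX (drop (2 * m - 1) vs)"
      unfolding alt_append using len by simp
    moreover have "[] \<notin> set (tl (drop (2 * m - 1) vs))"
      using vs by (metis in_set_dropD list.set_sel(2) tl_Nil)
    moreover have "even (length (drop (2 * m - 1) vs))"
      using len vs(2) by simp
    moreover have "padded (D @ [x])" if "alt LX D" "[] \<notin> set (tl D)" "even (length D)" for D
      using x that by (cases D) (simp_all add: padded_def alt_append butlast_append)
    ultimately have "padded (drop (2 * m - 1) vs @ [x])"
      by blast
    then show ?thesis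
      using EpsiX_concat by fastforce
  qed
  have "EpsiX \<psi> (concat vs @ x) = block_expect \<psi> ([] # vs @ [x])"
    using EpsiX_concat[OF pad] by simp
  also have "\<dots> = (\<Sum>m\<in>{1..Suc (length vs div 2)}. ?f (2 * m - 2))"
    unfolding block_expect_Cons[OF vs(2)]
  proof (intro sum.cong refl)
    fix m assume m: "m \<in> {1..Suc (length vs div 2)}"
    then have "Suc (2 * m - 2) = 2 * m - 1"
      by auto
    then show "bcum \<psi> (take (2 * m - 1) vs) *s pmult (monom []) (block_expect \<psi> (drop (2 * m - 1) vs @ [x])) =
        ?f (2 * m - 2)"
      using E[OF m] by (simp flip: pone_def)
  qed
  also have "\<dots> = (\<Sum>j<Suc (2 * (length vs div 2)). if odd j then 0 else ?f j)"
    by (subst sum_even_indices) auto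
  also have "\<dots> = (\<Sum>j<length vs. ?f j)"
  proof (rule sum.cong)
    fix j assume "j \<in> {..<length vs}"
    then show "(if odd j then 0 else ?f j) = ?f j"
      using psi.bcum_even[OF alt_take[OF vs(1)], of "Suc j"] by auto
  qed (use vs in auto)
  finally show ?thesis .
qed

text \<open>Extends the preceding expansion to tuples with empty entries. The functional \<theta> is
  arbitrary because a left factor from C<X> will later be absorbed into it.\<close>

lemma defect_EpsiX:
  assumes "alt LY vs" "odd (length vs)" "set x \<subseteq> {LX}"
  shows "defect \<psi> (\<lambda>w. lin \<theta> (EpsiX \<psi> (w @ x))) vs = 0"
  using assms
proof (induction "length vs" arbitrary: vs x rule: less_induct)
  case less
  show ?case
  proof (cases "[] \<in> set vs")
    case False
    then show ?thesis
      using less.prems by (subst defect_def, subst EpsiX_expand) (auto simp: bsum_def lin_sum lin_psmult)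
  next
    case True
    then obtain p q where pq: "vs = p @ [] # q"
      by (meson split_list)
    show ?thesis
    proof (cases "q = []")
      case False
      show ?thesis
      proof (rule defect_empty_entry[where \<theta> = \<psi> and c = LY, OF unit_psi _ _ pq False])
        show "bcum \<psi> us = 0" if "alt c us" "even (length us)" for c us
          using that by (rule psi.bcum_even)
      next
        show "defect \<psi> (\<lambda>w. lin \<theta> (EpsiX \<psi> (w @ x))) us = 0"
          if "length us < length vs" "odd (length us)" "alt LY us" for us
          by (rule less.hyps[OF that(1,3,2) less.prems(3)])
      qed (use less.prems in simp_all)
    next
      \<comment> \<open>When the last entry is empty, its predecessor \<open>a\<close> lies in C<X>
        and joins the trailing word \<open>x\<close>. The extra term has an even cumulant, hence is
        zero.\<close>
      case q: True
      show ?thesis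
      proof (cases p rule: rev_cases)
        case Nil
        then show ?thesis
          using pq q by (simp add: defect_first_Nil unit_psi)
      next
        case (snoc p' a)
        have alt: "alt LY p'" "odd (length p')" "set a \<subseteq> {LX}" "alt LY (p' @ [a])"
          using less.prems pq q snoc by (auto simp: alt_append split: if_splits)
        have "defect \<psi> (\<lambda>w. lin \<theta> (EpsiX \<psi> (w @ a @ x))) p' = 0"
          using alt pq snoc less.prems by (intro less.hyps) auto
        moreover have "bcum \<psi> (p' @ [a]) = 0"
          using alt by (intro psi.bcum_even) auto
        moreover have "defect \<psi> (\<lambda>w. lin \<theta> (EpsiX \<psi> (w @ x))) vs =
            defect \<psi> (\<lambda>w. lin \<theta> (EpsiX \<psi> (w @ x))) (p' @ [a])"
          using pq q snoc defect_Nil_after[of \<psi> _ p' a "[]"] by (simp add: unit_psi)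
        ultimately show ?thesis
          by (simp add: defect_def bsum_append bsum_Cons)
      qed
    qed
  qed
qed

text \<open>The recursion holds at every tuple met in the centring, so it may be centred as a whole;
  each term then contains a centred \<psi>-cumulant of positive length.\<close>

lemma cent_EpsiX:
  assumes "alt LY vs" "odd (length vs)" "set x \<subseteq> {LX}"
  shows "cent \<psi> (\<lambda>v. lin \<theta> (EpsiX \<psi> (concat v @ x))) vs = 0"
proof -
  let ?h = "\<lambda>w. lin \<theta> (EpsiX \<psi> (w @ x))"
  have "cent \<psi> (\<lambda>v. ?h (concat v)) vs = cent \<psi> (bsum \<psi> ?h []) vs"
  proof (rule cent_cong)
    fix us assume us: "sub_entries us vs"
    then have "defect \<psi> ?h us = 0"
      using assms alt_sub_entries list_all2_lengthD by (intro defect_EpsiX) fastforce+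
    then show "?h (concat us) = bsum \<psi> ?h [] us"
      by (simp add: defect_def)
  qed
  also have "\<dots> = 0"
    unfolding cent_bsum
  proof (intro sum.neutral ballI)
    fix j assume "j \<in> {..<length vs}"
    then have "cent \<psi> (bcum \<psi>) (take (Suc j) vs) = 0"
      by (intro cent_bcum_psi[OF alt_take[OF assms(1)]]) auto
    then show "cent \<psi> (bcum \<psi>) (take (Suc j) vs) *
        cent \<psi> (\<lambda>v. ?h (concat v)) (drop (Suc j) vs) = 0"
      by simp
  qed
  finally show ?thesis
    by simp
qed

text \<open>All entries but the last are centred, since removing a unit requires an entry after it.
  If anything remains to centre, the three parts of the defect (moment, inner sum, top cumulant)
  vanish separately.\<close>

lemma defect_phi_EpsiX:
  assumes "alt LX us" "odd (length us)"
  shows "defect \<phi> (\<lambda>w. lin \<phi> (EpsiX \<psi> w)) us = 0"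
  using assms
proof (induction "length us" arbitrary: us rule: less_induct)
  case less
  let ?e = "\<lambda>w. lin \<phi> (EpsiX \<psi> w)"
  obtain vs x where us: "us = vs @ [x]"
    using less.prems by (cases us rule: rev_cases) auto
  have x: "set x \<subseteq> {LX}" and vs: "alt LX vs" "even (length vs)"
    using less.prems us by (auto simp: alt_append)
  have "defect \<phi> ?e us = cent \<psi> (\<lambda>v. defect \<phi> ?e (v @ [x])) vs"
    unfolding us
  proof (rule cent_eq_self[symmetric])
    fix ws assume ws: "sub_entries ws vs" "[] \<in> set ws"
    then obtain p q where "ws = p @ [] # q"
      by (meson split_list)
    then have eq: "ws @ [x] = p @ [] # (q @ [x])"
      by simp
    have len: "length (ws @ [x]) = length us"
      using us list_all2_lengthD[OF ws(1)] by simp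
    show "defect \<phi> ?e (ws @ [x]) = 0"
    proof (rule defect_empty_entry[where \<theta> = \<phi> and c = LX, OF unit_phi _ _ eq])
      show "bcum \<phi> us = 0" if "alt c us" "even (length us)" for c us
        using that by (rule bcum_even)
    next
      show "defect \<phi> ?e zs = 0"
        if "length zs < length (ws @ [x])" "odd (length zs)" "alt LX zs" for zs
        by (rule less.hyps[OF _ that(3,2)]) (use that(1) len in simp)
      show "odd (length (ws @ [x]))"
        using len less.prems by simp
      show "alt LX (ws @ [x])"
        using alt_sub_entries[OF ws(1) vs(1)] list_all2_lengthD[OF ws(1)] vs x
        by (simp add: alt_append)
    qed simp_all
  qed
  also have "\<dots> = 0"
  proof (cases vs)
    case Nil
    then show ?thesis
      using x by (simp add: defect_def bsum_Cons EpsiX_pure unit_phi)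
  next
    case (Cons a ys)
    have ys: "alt LY ys" "odd (length ys)" "set a \<subseteq> {LX}"
      using vs Cons by auto
    \<comment> \<open>The first entry comes out of E^psi_X as a left factor. Both terms of its
      centring are then functionals of E^psi_X on a centred tuple starting in C<Y>.\<close>
    have 1: "cent \<psi> (\<lambda>v. ?e (concat v @ x)) vs = 0"
      using cent_EpsiX[OF ys(1,2) x, of \<phi>] cent_EpsiX[OF ys(1,2) x, of "\<lambda>w. \<phi> (a @ w)"] ys
      by (simp add: Cons EpsiX_append lin_monom_pmult)
    have "cent \<psi> (bcum \<phi>) (take (Suc j) vs) * cent \<psi> (\<lambda>v. ?e (concat v @ x)) (drop (Suc j) vs) = 0"
      if "j < length vs" for j
    \<comment> \<open>After the first cut the cofactor starts in C<Y> and vanishes; at later cuts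
      the centred cumulant has length at least two.\<close>
    proof (cases "j = 0")
      case True
      then show ?thesis
        using cent_EpsiX[OF ys(1,2) x, of \<phi>] Cons by simp
    next
      case False
      then show ?thesis
        using that by (simp add: cent_bcum[OF alt_take[OF vs(1)]])
    qed
    then have 2: "cent \<psi> (bsum \<phi> (\<lambda>w. ?e (w @ x)) []) vs = 0"
      unfolding cent_bsum by (intro sum.neutral) auto
    have "cent \<psi> (bcum \<phi>) (vs @ [x]) = 0"
      using less.prems us Cons by (intro cent_bcum[of LX]) auto
    \<comment> \<open>Keeping \<open>x\<close> uncentred changes the top cumulant only by a multiple
      of one with an empty last entry, which is zero.\<close>
    moreover have "cent \<psi> (\<lambda>v. bcum \<phi> (v @ [[]])) vs = cent \<psi> (\<lambda>_. 0) vs"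
      using Cons by (intro cent_cong bcum_last_Nil unit_phi) auto
    ultimately have 3: "cent \<psi> (\<lambda>v. bcum \<phi> (v @ [x])) vs = 0"
      by (simp add: cent_snoc)
    have "cent \<psi> (\<lambda>v. defect \<phi> ?e (v @ [x])) vs = cent \<psi> (\<lambda>v. ?e (concat v @ x) -
        bsum \<phi> (\<lambda>w. ?e (w @ x)) [] v - 1 * bcum \<phi> (v @ [x])) vs"
      by (intro cent_cong) (simp add: defect_def bsum_append bsum_Cons unit_phi)
    then show ?thesis
      using 1 2 3 by (simp only: cent_diff cent_cmult) simp
  qed
  finally show ?case .
qed

end

subsection \<open>Deconcatenation in block form\<close>

text \<open>The deconcatenation sum over all positions with a conditional summand, instead of a
  filtered index set as in \<open>tens\<close>, so that it unfolds along the word.\<close>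

definition cutsum :: "letter \<Rightarrow> (word \<Rightarrow> word \<Rightarrow> 'a :: comm_monoid_add) \<Rightarrow> word \<Rightarrow> 'a" where
  "cutsum c g W = (\<Sum>i<length W. if W ! i = c then g (take i W) (drop i W) else 0)"

lemma tens_cutsum: "tens f F c W = cutsum c (\<lambda>U V. f U *s F V) W"
  unfolding tens_def cutsum_def
  by (subst sum.inter_filter[symmetric]) (auto intro: sum.cong)

lemma cutsum_Nil [simp]: "cutsum c g [] = 0"
  by (simp add: cutsum_def)

lemma cutsum_Cons:
  "cutsum c g (a # W) = (if a = c then g [] (a # W) else 0) + cutsum c (\<lambda>U. g (a # U)) W"
  by (simp add: cutsum_def sum.lessThan_Suc_shift del: sum.lessThan_Suc cong: if_cong)

lemma cutsum_append:
  "cutsum c g (u @ W) = cutsum c (\<lambda>U V. g U (V @ W)) u + cutsum c (\<lambda>U. g (u @ U)) W"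
  by (induction u arbitrary: g) (simp_all add: cutsum_Cons add.assoc)

lemma cutsum_cong:
  "(\<And>i. i < length W \<Longrightarrow> W ! i = c \<Longrightarrow> g (take i W) (drop i W) = g' (take i W) (drop i W)) \<Longrightarrow>
    cutsum c g W = cutsum c g' W"
  unfolding cutsum_def by (rule sum.cong) auto

lemma cutsum_pure_other:
  assumes "set u \<subseteq> {c}"
  shows "cutsum (other c) g u = 0"
  unfolding cutsum_def
proof (intro sum.neutral ballI)
  fix i assume "i \<in> {..<length u}"
  then have "u ! i = c"
    using assms nth_mem[of i u] by blast
  then show "(if u ! i = other c then g (take i u) (drop i u) else 0) = 0"
    by simp
qed

text \<open>A cut strictly inside the block leaves a nonempty left factor ending in
  \<open>c\<close>, which \<open>g\<close> annihilates.\<close>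

lemma cutsum_pure_same:
  assumes "set u \<subseteq> {c}" "u \<noteq> []" "\<And>U V. U \<noteq> [] \<Longrightarrow> last U = c \<Longrightarrow> g U V = 0"
  shows "cutsum c g u = g [] u"
proof -
  obtain a u' where u: "u = a # u'"
    using assms by (cases u) auto
  have "g (a # take i u') (drop i u') = 0" for i
  proof (rule assms(3))
    have "last (a # take i u') \<in> set (a # take i u')"
      by (rule last_in_set) simp
    then show "last (a # take i u') = c"
      using assms(1) set_take_subset[of i u'] u by auto
  qed simp
  then have "cutsum c (\<lambda>U. g (a # U)) u' = 0"
    unfolding cutsum_def by (intro sum.neutral) auto
  then show ?thesis
    using assms u by (simp add: cutsum_Cons)
qed

text \<open>Only cuts at the start of a block of the other letter survive, and these come after an
  odd number of blocks.\<close>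

lemma cutsum_blocks:
  assumes "alt c us" "[] \<notin> set us"
    and "\<And>U V. U \<noteq> [] \<Longrightarrow> last U = other c \<Longrightarrow> g U V = 0"
  shows "cutsum (other c) g (concat us) =
    (\<Sum>k<length us. if odd k then g (concat (take k us)) (concat (drop k us)) else 0)"
  using assms
proof (induction "length us" arbitrary: us g rule: less_induct)
  case less
  consider "us = []" | u where "us = [u]" | u v us' where "us = u # v # us'"
    by (metis list.exhaust)
  then show ?case
  proof cases
    case 2
    then show ?thesis
      using less.prems cutsum_pure_other[of u c g] by simp
  next
    case 3
    have u: "set u \<subseteq> {c}" and v: "set v \<subseteq> {other c}" "v \<noteq> []" and us': "alt c us'" "[] \<notin> set us'"
      using less.prems 3 by auto
    have g: "g (u @ U) V = 0" if "U \<noteq> []" "last U = other c" for U V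
      using less.prems(3) that by simp
    have "cutsum (other c) g (concat us) = cutsum (other c) (\<lambda>U. g (u @ U)) (v @ concat us')"
      using 3 cutsum_pure_other[OF u, of "\<lambda>U V. g U (V @ v @ concat us')"]
      by (simp add: cutsum_append)
    also have "\<dots> = g u (v @ concat us') + cutsum (other c) (\<lambda>U. g (u @ v @ U)) (concat us')"
      using cutsum_pure_same[OF v, of "\<lambda>U V. g (u @ U) (V @ concat us')"] g
      by (simp add: cutsum_append)
    also have "cutsum (other c) (\<lambda>U. g (u @ v @ U)) (concat us') =
        (\<Sum>k<length us'. if odd k then g (u @ v @ concat (take k us')) (concat (drop k us')) else 0)"
      using us' 3 less.prems(3) by (intro less.hyps) auto
    finally show ?thesis
      using 3 by (simp add: sum.lessThan_Suc_shift del: sum.lessThan_Suc cong: if_cong)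
  qed simp
qed

lemma hd_concat_alt: "alt c us \<Longrightarrow> [] \<notin> set us \<Longrightarrow> us \<noteq> [] \<Longrightarrow> hd (concat us) = c"
  by (cases us; cases "hd us") auto

lemma last_concat_alt:
  assumes "alt c us" "[] \<notin> set us" "us \<noteq> []"
  shows "last (concat us) = (if odd (length us) then c else other c)"
proof -
  obtain vs u where us: "us = vs @ [u]"
    using assms by (cases us rule: rev_cases) auto
  then have "u \<noteq> []" "set u \<subseteq> {if even (length vs) then c else other c}"
    using assms by (auto simp: alt_append)
  then have "last u = (if even (length vs) then c else other c)"
    using last_in_set[of u] by blast
  then show ?thesis
    using us \<open>u \<noteq> []\<close> by simp
qed

lemma bb_concat:
  assumes "alt c us" "[] \<notin> set us" "us \<noteq> []"
  shows "bb \<theta> c (concat us) = (if odd (length us) then bcum \<theta> us else 0)"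
proof -
  have "concat us \<noteq> []"
    using assms by (cases us) auto
  then show ?thesis
    unfolding bb_def hd_concat_alt[OF assms] last_concat_alt[OF assms] blocks_concat[OF assms(1,2)]
    by auto
qed

lemma blocks_exist:
  "W \<noteq> [] \<Longrightarrow> \<exists>us. us \<noteq> [] \<and> alt (hd W) us \<and> [] \<notin> set us \<and> concat us = W"
proof (induction W)
  case (Cons a W)
  show ?case
  proof (cases "W = []")
    case True
    then show ?thesis
      by (intro exI[of _ "[[a]]"]) simp
  next
    case False
    then obtain u us where us: "alt (hd W) (u # us)" "[] \<notin> set (u # us)" "concat (u # us) = W"
      using Cons.IH by (metis list.exhaust)
    show ?thesis
    proof (cases "hd W = a")
      case True
      then show ?thesis
        using us by (intro exI[of _ "(a # u) # us"]) auto
    next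
      case False
      then have "hd W = other a"
        by (simp add: neq_other_iff)
      then show ?thesis
        using us by (intro exI[of _ "[a] # u # us"]) auto
    qed
  qed
qed simp

text \<open>Turns the letterwise recursions (iii) and (iv) into a full Boolean recursion over
  blocks. The separate \<beta>-term is the cut at the end of the word.\<close>

lemma bb_tens_blocks:
  assumes us: "alt c us" "[] \<notin> set us" "us \<noteq> []"
    and even0: "\<And>c us. alt c us \<Longrightarrow> even (length us) \<Longrightarrow> bcum \<theta> us = 0"
  shows "bb \<theta> c (concat us) *s F [] + tens (bb \<theta> c) F (other c) (concat us) =
    (\<Sum>j<length us. bcum \<theta> (take (Suc j) us) *s F (concat (drop (Suc j) us)))"
proof -
  let ?t = "\<lambda>k. if odd k then bcum \<theta> (take k us) *s F (concat (drop k us)) else 0"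
  have bb: "bb \<theta> c (concat (take k us)) = bcum \<theta> (take k us)" if "odd k" "k \<le> length us" for k
  proof -
    have "[] \<notin> set (take k us)" "take k us \<noteq> []" "odd (length (take k us))"
      using us that odd_pos[of k] by (auto dest: in_set_takeD)
    then show ?thesis
      using bb_concat[OF alt_take[OF us(1)], of k] by simp
  qed
  have "tens (bb \<theta> c) F (other c) (concat us) = (\<Sum>k<length us.
      if odd k then bb \<theta> c (concat (take k us)) *s F (concat (drop k us)) else 0)"
    unfolding tens_cutsum by (rule cutsum_blocks[OF us(1,2)]) (simp add: bb_def)
  also have "\<dots> = (\<Sum>k<length us. ?t k)"
    by (intro sum.cong) (auto simp: bb)
  finally have "bb \<theta> c (concat us) *s F [] + tens (bb \<theta> c) F (other c) (concat us) =
      (\<Sum>k<Suc (length us). ?t k)"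
    using bb_concat[OF us] by (simp add: add.commute)
  also have "\<dots> = (\<Sum>j<length us. ?t (Suc j))"
    unfolding sum.lessThan_Suc_shift by simp
  \<comment> \<open>The even lengths are put back, with zero cumulants.\<close>
  also have "\<dots> = (\<Sum>j<length us. bcum \<theta> (take (Suc j) us) *s F (concat (drop (Suc j) us)))"
    using even0[OF alt_take[OF us(1)]] by (intro sum.cong) auto
  finally show ?thesis .
qed

subsection \<open>The right quasi-conditional expectation\<close>

text \<open>The existence witness. Testing for pure X-words first also disposes of the unit, so
  \<open>hd W\<close> is consulted only for nonempty words. Clause (ii) is recovered from (iii),
  which has no cut on a pure Y-word.\<close>

function quasi_expect :: "(word \<Rightarrow> complex) \<Rightarrow> (word \<Rightarrow> complex) \<Rightarrow> word \<Rightarrow> ncpoly" where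
  "quasi_expect \<phi> \<psi> W = (if set W \<subseteq> {LX} then monom W
     else if hd W = LY then bb \<phi> LY W *s pone +
       (\<Sum>i\<in>{i. i < length W \<and> W ! i = LX}. bb \<phi> LY (take i W) *s quasi_expect \<phi> \<psi> (drop i W))
     else EpsiX \<psi> W + (\<Sum>i\<in>{i. i < length W \<and> W ! i = LY}.
       bb \<phi> LX (take i W) *s (quasi_expect \<phi> \<psi> (drop i W) - EpsiX \<psi> (drop i W))))"
  by auto
termination
proof (relation "measure (\<lambda>(\<phi>, \<psi>, W). length W)", goal_cases)
  case (2 \<phi> \<psi> W i)
  \<comment> \<open>The word does not begin with the letter at which it is cut, so the right factor
    is strictly shorter.\<close>
  then have "i \<noteq> 0"
    by (auto simp: hd_conv_nth)
  with 2 show ?case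
    by auto
next
  case (3 \<phi> \<psi> W i)
  then have "i \<noteq> 0"
    by (auto simp: hd_conv_nth)
  with 3 show ?case
    by auto
qed simp

declare quasi_expect.simps [simp del]

lemma bb_pure: "set W \<subseteq> {c} \<Longrightarrow> W \<noteq> [] \<Longrightarrow> bb \<theta> c W = \<theta> W"
  using bb_concat[of c "[W]" \<theta>] by simp

text \<open>The clauses of \<open>Espec\<close> overlap on pure words, so well-definedness includes
  their agreement there: no cut exists, and the cumulant of a single block is its moment.\<close>

lemma Espec_quasi_expect:
  assumes "\<phi> [] = 1"
  shows "Espec \<phi> \<psi> (quasi_expect \<phi> \<psi>)"
  unfolding Espec_def
proof (intro conjI allI impI)
  fix W assume W: "set W \<subseteq> {LX}"
  then show "quasi_expect \<phi> \<psi> W = monom W"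
    by (simp add: quasi_expect.simps)
next
  fix W assume W: "set W \<subseteq> {LY}"
  show "quasi_expect \<phi> \<psi> W = \<phi> W *s pone"
  proof (cases "W = []")
    case True
    then show ?thesis
      using assms by (simp add: quasi_expect.simps pone_def psmult_def)
  next
    case False
    then have "hd W = LY" "\<not> set W \<subseteq> {LX}"
      using W by (cases W; auto)+
    moreover have "tens (bb \<phi> LY) (quasi_expect \<phi> \<psi>) LX W = 0"
      using cutsum_pure_other[OF W] by (simp add: tens_cutsum)
    ultimately show ?thesis
      using bb_pure[OF W False] by (subst quasi_expect.simps) (simp add: tens_def)
  qed
next
  fix W assume W: "W \<noteq> [] \<and> hd W = LY"
  then have "\<not> set W \<subseteq> {LX}"
    by (cases W) auto
  with W show "quasi_expect \<phi> \<psi> W = bb \<phi> LY W *s pone + tens (bb \<phi> LY) (quasi_expect \<phi> \<psi>) LX W"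
    by (subst quasi_expect.simps) (simp add: tens_def)
next
  fix W assume W: "W \<noteq> [] \<and> hd W = LX"
  show "quasi_expect \<phi> \<psi> W = EpsiX \<psi> W +
      tens (bb \<phi> LX) (\<lambda>V. quasi_expect \<phi> \<psi> V - EpsiX \<psi> V) LY W"
  proof (cases "set W \<subseteq> {LX}")
    case True
    then show ?thesis
      using cutsum_pure_other[OF True] by (simp add: quasi_expect.simps EpsiX_pure tens_cutsum)
  next
    case False
    with W show ?thesis
      by (subst quasi_expect.simps) (simp add: tens_def)
  qed
qed

text \<open>Makes induction on length applicable under \<open>tens\<close>: the first letter is not
  a cut, so all right factors are shorter.\<close>

lemma tens_cong:
  assumes "W = [] \<or> hd W \<noteq> c" "\<And>V. length V < length W \<Longrightarrow> F V = G V"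
  shows "tens f F c W = tens f G c W"
  unfolding tens_cutsum
proof (rule cutsum_cong)
  fix i assume "i < length W" "W ! i = c"
  then have "i \<noteq> 0"
    using assms(1) by (cases W; cases i) auto
  then show "f (take i W) *s F (drop i W) = f (take i W) *s G (drop i W)"
    using \<open>i < length W\<close> by (simp add: assms(2))
qed

lemma Espec_unique:
  assumes "Espec \<phi> \<psi> E" "Espec \<phi> \<psi> E'"
  shows "E W = E' W"
proof (induction "length W" arbitrary: W rule: less_induct)
  case less
  show ?case
  proof (cases "W = []")
    case True
    then show ?thesis
      using assms by (simp add: Espec_def)
  next
    case False
    show ?thesis
    proof (cases "hd W")
      case LX
      have "tens (bb \<phi> LX) (\<lambda>V. E V - EpsiX \<psi> V) LY W = tens (bb \<phi> LX) (\<lambda>V. E' V - EpsiX \<psi> V) LY W"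
        by (intro tens_cong) (auto simp: LX less)
      then show ?thesis
        using assms False LX by (simp add: Espec_def)
    next
      case LY
      have "tens (bb \<phi> LY) E LX W = tens (bb \<phi> LY) E' LX W"
        by (intro tens_cong) (auto simp: LY less)
      then show ?thesis
        using assms False LY by (simp add: Espec_def)
    qed
  qed
qed

lemma pmult_cutsum_left: "pmult (cutsum c g W) R = cutsum c (\<lambda>U V. pmult (g U V) R) W"
  unfolding cutsum_def pmult_sum_left by (rule sum.cong) auto

lemma sum_ncpoly_apply: "(\<Sum>u\<in>A. f u) w = (\<Sum>u\<in>A. (f u :: ncpoly) w)"
  by (induction A rule: infinite_finite_induct) (simp_all add: plus_fun_apply zero_fun_apply)

lemma poly_eq_sum_monoms: "is_poly P \<Longrightarrow> P = (\<Sum>u\<in>{u. P u \<noteq> 0}. P u *s monom u)"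
proof
  fix w assume "is_poly P"
  have "(\<Sum>u\<in>{u. P u \<noteq> 0}. P u *s monom u) w = (\<Sum>u\<in>{u. P u \<noteq> 0}. if u = w then P u else 0)"
    by (auto simp: sum_ncpoly_apply psmult_def monom_def intro!: sum.cong)
  also have "\<dots> = P w"
    using \<open>is_poly P\<close> by (simp add: is_poly_def sum.delta')
  finally show "P w = (\<Sum>u\<in>{u. P u \<noteq> 0}. P u *s monom u) w"
    by simp
qed

lemma linE_eq_sum: "linE E P = (\<Sum>u\<in>{u. P u \<noteq> 0}. P u *s E u)"
  by (simp add: linE_def psmult_def fun_eq_iff sum_ncpoly_apply)

text \<open>For a fixed coefficient \<open>v\<close>, \<open>linE E\<close> is the functional
  \<open>lin (\<lambda>w. E w v)\<close>. Linearity of \<open>lin\<close> then reduces the claim to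
  monomials.\<close>

lemma linE_pmult:
  assumes P: "is_poly P" and Q: "in_alg c Q"
    and E: "\<And>u x. set x \<subseteq> {c} \<Longrightarrow> E (u @ x) = pmult (E u) (monom x)"
  shows "linE E (pmult P Q) = pmult (linE E P) Q"
proof
  fix v
  have Qp: "is_poly Q"
    using Q by (simp add: in_alg_def)
  have Eu: "lin (\<lambda>w. E (u @ w) v) Q = pmult (E u) Q v" for u
  proof -
    have "lin (\<lambda>w. E (u @ w) v) Q = (\<Sum>w\<in>{w. Q w \<noteq> 0}. Q w * pmult (E u) (monom w) v)"
      unfolding lin_def using Q by (intro sum.cong) (auto simp: E in_alg_def)
    also have "\<dots> = linE (\<lambda>w. pmult (E u) (monom w)) Q v"
      by (simp add: linE_def)
    also have "\<dots> = pmult (E u) (\<Sum>w\<in>{w. Q w \<noteq> 0}. Q w *s monom w) v"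
      by (simp add: linE_eq_sum pmult_sum_right pmult_psmult_right)
    finally show ?thesis
      using poly_eq_sum_monoms[OF Qp] by simp
  qed
  have "pmult P Q = (\<Sum>u\<in>{u. P u \<noteq> 0}. P u *s pmult (monom u) Q)"
    by (subst poly_eq_sum_monoms[OF P]) (simp add: pmult_sum_left pmult_psmult_left)
  then have "linE E (pmult P Q) v = lin (\<lambda>w. E w v) (\<Sum>u\<in>{u. P u \<noteq> 0}. P u *s pmult (monom u) Q)"
    by (simp add: linE_def lin_def)
  also have "\<dots> = (\<Sum>u\<in>{u. P u \<noteq> 0}. P u * pmult (E u) Q v)"
    using Qp by (simp add: lin_sum lin_psmult lin_monom_pmult Eu)
  also have "\<dots> = linE (\<lambda>u. pmult (E u) Q) P v"
    by (simp add: linE_def)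
  also have "\<dots> = pmult (linE E P) Q v"
    by (simp add: linE_eq_sum pmult_sum_left pmult_psmult_left)
  finally show "linE E (pmult P Q) v = pmult (linE E P) Q v" .
qed

lemma bb_last_neq: "W \<noteq> [] \<Longrightarrow> last W \<noteq> c \<Longrightarrow> bb \<theta> c W = 0"
  by (simp add: bb_def)

lemma bb_hd_neq: "W \<noteq> [] \<Longrightarrow> hd W \<noteq> c \<Longrightarrow> bb \<theta> c W = 0"
  by (simp add: bb_def)

text \<open>The correction by \<open>eps\<close> is felt only at an empty left factor, that is, at a
  cut before the first letter.\<close>

lemma tens_bbo_same:
  assumes "W = [] \<or> hd W \<noteq> c"
  shows "tens (bbo \<theta> d) F c W = tens (bb \<theta> d) F c W"
  unfolding tens_cutsum
proof (rule cutsum_cong)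
  fix i assume "i < length W" "W ! i = c"
  then have "i \<noteq> 0"
    using assms by (cases W; cases i) auto
  then show "bbo \<theta> d (take i W) *s F (drop i W) = bb \<theta> d (take i W) *s F (drop i W)"
    using \<open>i < length W\<close> by (auto simp: bbo_def eps_def)
qed

lemma tens_bbo_zero:
  assumes "W = [] \<or> hd W \<noteq> d"
  shows "tens (bbo \<theta> d) F c W = 0"
proof -
  have "bbo \<theta> d (take i W) = 0" for i
    using assms by (cases "take i W = []") (auto simp: bbo_def eps_def bb_def)
  then show ?thesis
    by (simp add: tens_def)
qed

section \<open>Properties of an arbitrary solution of the recursion\<close>

locale right_quasi_expectation = cfree_pair +
  fixes E :: "word \<Rightarrow> ncpoly"
  assumes spec: "Espec \<phi> \<psi> E"
begin

lemma E_pure: "set W \<subseteq> {LX} \<Longrightarrow> E W = monom W"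
  using spec by (simp add: Espec_def)

lemma E_Nil [simp]: "E [] = pone"
  by (simp add: E_pure pone_def)

lemma E_LY: "W \<noteq> [] \<Longrightarrow> hd W = LY \<Longrightarrow> E W = bb \<phi> LY W *s pone + tens (bb \<phi> LY) E LX W"
  using spec by (simp add: Espec_def)

lemma E_LX:
  "W \<noteq> [] \<Longrightarrow> hd W = LX \<Longrightarrow> E W = EpsiX \<psi> W + tens (bb \<phi> LX) (\<lambda>V. E V - EpsiX \<psi> V) LY W"
  using spec by (simp add: Espec_def)

lemma drop_shorter: "i < length W \<Longrightarrow> W ! i \<noteq> hd W \<Longrightarrow> length (drop i W) < length W"
  by (cases "i = 0") (auto simp: hd_conv_nth)

lemma in_alg_E: "in_alg LX (E W)"
proof (induction "length W" arbitrary: W rule: less_induct)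
  case less
  consider "W = []" | "W \<noteq> []" "hd W = LX" | "W \<noteq> []" "hd W = LY"
    by (cases "hd W") auto
  then show ?case
  proof cases
    case 2
    then show ?thesis
      unfolding E_LX[OF 2] tens_def
      by (intro in_alg_add in_alg_sum in_alg_psmult in_alg_diff in_alg_EpsiX less)
        (use drop_shorter[of _ W] in simp)
  next
    case 3
    then show ?thesis
      unfolding E_LY[OF 3] tens_def
      by (intro in_alg_add in_alg_sum in_alg_psmult in_alg_pone less)
        (use drop_shorter[of _ W] in simp)
  qed simp
qed

lemma is_poly_E [simp]: "is_poly (E W)"
  using in_alg_E by (simp add: in_alg_def)

text \<open>For \<open>W\<close> starting with X, appending \<open>x\<close> creates no new Y-cut,
  and E^psi_X is a right module map. For \<open>W\<close> starting with Y, the new X-cuts must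
  compensate for the loss of the constant term.\<close>

lemma E_append_right:
  assumes "set x \<subseteq> {LX}" "x \<noteq> []"
  shows "E (W @ x) = pmult (E W) (monom x)"
proof (induction "length W" arbitrary: W rule: less_induct)
  case less
  consider "W = []" | "W \<noteq> []" "hd W = LX" | "W \<noteq> []" "hd W = LY"
    by (cases "hd W") auto
  then show ?case
  proof cases
    case 1
    then show ?thesis
      using assms by (simp add: E_pure)
  next
    case 2
    have "E (W @ x) = EpsiX \<psi> (W @ x) + tens (bb \<phi> LX) (\<lambda>V. E V - EpsiX \<psi> V) LY (W @ x)"
      using 2 by (intro E_LX) auto
    also have "tens (bb \<phi> LX) (\<lambda>V. E V - EpsiX \<psi> V) LY (W @ x) =
        tens (bb \<phi> LX) (\<lambda>V. E (V @ x) - EpsiX \<psi> (V @ x)) LY W"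
      using cutsum_pure_other[OF assms(1)] by (simp add: tens_cutsum cutsum_append)
    also have "\<dots> = tens (bb \<phi> LX) (\<lambda>V. pmult (E V - EpsiX \<psi> V) (monom x)) LY W"
      using assms 2 by (intro tens_cong) (auto simp: less EpsiX_append_right pmult_diff_left)
    also have "EpsiX \<psi> (W @ x) + \<dots> = pmult (E W) (monom x)"
      unfolding E_LX[OF 2] tens_cutsum
      using assms by (simp add: EpsiX_append_right pmult_add_left pmult_cutsum_left pmult_psmult_left)
    finally show ?thesis .
  next
    case 3
    have "last x = LX"
      using assms last_in_set[of x] by blast
    have "E (W @ x) = bb \<phi> LY (W @ x) *s pone + tens (bb \<phi> LY) E LX (W @ x)"
      using 3 by (intro E_LY) auto
    also have "bb \<phi> LY (W @ x) = 0"
      using assms \<open>last x = LX\<close> by (intro bb_last_neq) auto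
    also have "tens (bb \<phi> LY) E LX (W @ x) = tens (bb \<phi> LY) (\<lambda>V. E (V @ x)) LX W +
        cutsum LX (\<lambda>U V. bb \<phi> LY (W @ U) *s E V) x"
      by (simp add: tens_cutsum cutsum_append)
    \<comment> \<open>Of the cuts inside \<open>x\<close> only the one at its start survives. It
      yields the old constant term multiplied by \<open>x\<close>, replacing the term for
      \<open>W @ x\<close>, which is zero because that word ends in X.\<close>
    also have "cutsum LX (\<lambda>U V. bb \<phi> LY (W @ U) *s E V) x = bb \<phi> LY W *s monom x"
      using assms by (subst cutsum_pure_same) (auto simp: bb_last_neq E_pure)
    also have "tens (bb \<phi> LY) (\<lambda>V. E (V @ x)) LX W = tens (bb \<phi> LY) (\<lambda>V. pmult (E V) (monom x)) LX W"
      using 3 by (intro tens_cong) (auto simp: less)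
    also have "0 *s pone + (\<dots> + bb \<phi> LY W *s monom x) = pmult (E W) (monom x)"
      unfolding E_LY[OF 3] tens_cutsum
      by (simp add: pmult_add_left pmult_cutsum_left pmult_psmult_left add.commute)
    finally show ?thesis .
  qed
qed

text \<open>A tuple of even length ends in C<Y>. Appending an empty X-entry makes it odd and adds
  only a cumulant with empty last entry.\<close>

lemma defect_phi_EpsiX_blocks:
  assumes "alt LX us" "us \<noteq> []"
  shows "lin \<phi> (EpsiX \<psi> (concat us)) = bsum \<phi> (\<lambda>w. lin \<phi> (EpsiX \<psi> w)) [] us"
proof (cases "odd (length us)")
  case True
  then show ?thesis
    using defect_phi_EpsiX[OF assms(1)] by (simp add: defect_def)
next
  case False
  then have "defect \<phi> (\<lambda>w. lin \<phi> (EpsiX \<psi> w)) (us @ [[]]) = 0"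
    using assms by (intro defect_phi_EpsiX) (auto simp: alt_append)
  then show ?thesis
    using bcum_last_Nil[of \<phi>, OF unit_phi assms(2)] by (simp add: defect_def bsum_append bsum_Cons)
qed

lemma lin_phi_E: "lin \<phi> (E W) = \<phi> W"
proof (induction "length W" arbitrary: W rule: less_induct)
  case less
  show ?case
  proof (cases "W = []")
    case False
    then obtain us where us: "us \<noteq> []" "alt (hd W) us" "[] \<notin> set us" "concat us = W"
      using blocks_exist by blast
    have shorter: "length (concat (drop (Suc j) us)) < length W" for j
    proof -
      have "concat (take (Suc j) us) \<noteq> []"
        using us by (cases us) auto
      moreover have "W = concat (take (Suc j) us) @ concat (drop (Suc j) us)"
        using us by (simp flip: concat_append)
      ultimately show ?thesis
        by simp
    qed
    \<comment> \<open>Every tail is shorter than \<open>W\<close>, so the induction hypothesis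
      replaces \<phi> o E by \<phi>, and the sum becomes the moment expansion of
      \<open>W\<close>.\<close>
    have phi: "bsum \<phi> (\<lambda>w. lin \<phi> (E w)) [] us = \<phi> W"
      using moment_bsum[of \<phi>, OF unit_phi us(1)] us(4) less.hyps[OF shorter]
      by (simp add: bsum_def)
    show ?thesis
    proof (cases "hd W")
      case LX
      have "E W = EpsiX \<psi> W + (\<Sum>j<length us. bcum \<phi> (take (Suc j) us)
          *s (E (concat (drop (Suc j) us)) - EpsiX \<psi> (concat (drop (Suc j) us))))"
        using E_LX[OF False LX] us LX bb_tens_blocks[of LX us \<phi> "\<lambda>V. E V - EpsiX \<psi> V", OF _ us(3,1) bcum_even]
        by simp
      then have "lin \<phi> (E W) = lin \<phi> (EpsiX \<psi> W) +
          (bsum \<phi> (\<lambda>w. lin \<phi> (E w)) [] us - bsum \<phi> (\<lambda>w. lin \<phi> (EpsiX \<psi> w)) [] us)"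
        by (simp add: lin_add lin_sum is_poly_sum lin_psmult lin_diff bsum_def right_diff_distrib sum_subtractf)
      then show ?thesis
        using phi defect_phi_EpsiX_blocks[of us] us LX by simp
    next
      case LY
      have "E W = (\<Sum>j<length us. bcum \<phi> (take (Suc j) us) *s E (concat (drop (Suc j) us)))"
        using E_LY[OF False LY] us LY bb_tens_blocks[of LY us \<phi> E, OF _ us(3,1) bcum_even] by simp
      then show ?thesis
        using phi by (simp add: lin_sum lin_psmult bsum_def)
    qed
  qed (simp add: unit_phi)
qed

lemma lin_phi_linE: "is_poly P \<Longrightarrow> lin \<phi> (linE E P) = lin \<phi> P"
  by (simp add: linE_eq_sum lin_sum lin_psmult lin_phi_E) (simp add: lin_def)

lemma linE_E_pmult:
  assumes "is_poly P" "in_alg LX Q"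
  shows "linE E (pmult P Q) = pmult (linE E P) Q"
proof (rule linE_pmult[OF assms])
  fix u x assume "set x \<subseteq> {LX}"
  then show "E (u @ x) = pmult (E u) (monom x)"
    by (cases "x = []") (auto simp: E_append_right simp flip: pone_def)
qed

text \<open>The first letter decides which terms survive: \<open>bbo\<close> vanishes on the unit
  and on words starting with the wrong letter. For \<open>W\<close> starting with X, the term
  \<open>XEL\<close> is \<open>EpsiX\<close> of \<open>W\<close> because X pulls out on the
  left.\<close>

lemma E_uniform:
  "E W = bb \<phi> LY W *s pone + tens (bbo \<phi> LY) E LX W
     + tens (bbo \<phi> LX) (\<lambda>V. E V - EpsiX \<psi> V) LY W + XEL \<psi> W"
proof (cases W)
  case Nil
  then show ?thesis
    by (simp add: bb_def tens_bbo_zero XEL_def psmult_def)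
next
  case (Cons a W')
  show ?thesis
  proof (cases a)
    case LX
    then show ?thesis
      using E_LX[of W] EpsiX_append[of "[LX]" \<psi> W'] Cons
      by (simp add: tens_bbo_zero tens_bbo_same bb_hd_neq XEL_def add.commute)
  next
    case LY
    then show ?thesis
      using E_LY[of W] Cons by (simp add: tens_bbo_zero tens_bbo_same XEL_def)
  qed
qed

end

theorem theorem6:
  fixes \<phi> \<psi> :: "word \<Rightarrow> complex"
  assumes unit_phi: "\<phi> [] = 1" and unit_psi: "\<psi> [] = 1"
    and cf: "cfree \<phi> \<psi>"
  shows "(\<exists>!E. Espec \<phi> \<psi> E)
    \<and> (\<forall>E. Espec \<phi> \<psi> E \<longrightarrow>
          (\<forall>W. in_alg LX (E W))
        \<and> (\<forall>P. is_poly P \<longrightarrow> lin \<phi> (linE E P) = lin \<phi> P)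
        \<and> (\<forall>P Q. is_poly P \<and> in_alg LX Q \<longrightarrow> linE E (pmult P Q) = pmult (linE E P) Q)
        \<and> (\<forall>W. E W = bb \<phi> LY W *s pone + tens (bbo \<phi> LY) E LX W
                    + tens (bbo \<phi> LX) (\<lambda>V. E V - EpsiX \<psi> V) LY W + XEL \<psi> W))"
proof (intro conjI allI impI)
  show "\<exists>!E. Espec \<phi> \<psi> E"
    using Espec_quasi_expect[of \<phi> \<psi>, OF unit_phi] Espec_unique by blast
next
  fix E assume "Espec \<phi> \<psi> E"
  then interpret right_quasi_expectation \<phi> \<psi> E
    using assms by unfold_locales
  show "in_alg LX (E W)" for W
    by (rule in_alg_E)
  show "lin \<phi> (linE E P) = lin \<phi> P" if "is_poly P" for P
    using that by (rule lin_phi_linE)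
  show "linE E (pmult P Q) = pmult (linE E P) Q" if "is_poly P \<and> in_alg LX Q" for P Q
    using that linE_E_pmult by blast
  show "E W = bb \<phi> LY W *s pone + tens (bbo \<phi> LY) E LX W
     + tens (bbo \<phi> LX) (\<lambda>V. E V - EpsiX \<psi> V) LY W + XEL \<psi> W" for W
    by (rule E_uniform)
qed

end
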